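(* Let $u$ be a meromorphic function on $\mathbb{C}$ and $L_4=\partial_x^4+u(x)$. Suppose that $L_4$ commutes with a differential operator $M$ of order $4g+2$, that $M$ and $L_4$ are operators of rank $2$, and that $u$ has a pole at $a_i$. Let $n_i$ be the positive integer such that the coefficient of $(x-a_i)^{-4}$ in the Laurent expansion of $u$ at $a_i$ equals $n_i(4n_i+1)(4n_i+3)(4n_i+4)$. Then for every $\lambda\in\mathbb{C}$ the solutions of the equation $$\psi^{(4)}(x)+u(x)\psi(x)=\lambda\psi(x)$$ have singularities at $a_i$ of the following type: there is a fundamental system of solutions near $a_i$ of the form $(x-a_i)^{\sigma_{i,r}}g_r(x)$, $r=1,2,3,4$, where each $g_r$ is holomorphic at $a_i$ and $$\sigma_{i,1}=\tfrac12\left(1-4n_i-\sqrt{1-16n_i-16n_i^2}\right),\qquad \sigma_{i,2}=\tfrac12\left(1-4n_i+\sqrt{1-16n_i-16n_i^2}\right),$$ $$\sigma_{i,3}=\tfrac12\left(5+4n_i-\sqrt{1-16n_i-16n_i^2}\right),\qquad \sigma_{i,4}=\tfrac12\left(5+4n_i+\sqrt{1-16n_i-16n_i^2}\right).$$ Consequently, (nonzero) common eigenfunctions of the commuting operators always have branch points, and $L_4$ does not commute with any differential operator of odd order.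
   Context: Differential operators are ordinary scalar linear differential operators in $x$ (with meromorphic coefficients); $\partial_x=d/dx$. If two such operators $L,M$ commute, there is a nonzero polynomial $R(z,w)$ with $R(L,M)=0$, and if $L\psi=z\psi$, $M\psi=w\psi$ with $\psi\ne0$ then $(z,w)$ lies on the spectral curve $R(z,w)=0$. The rank of the pair is the dimension of the space of common eigenfunctions $\{\psi: L\psi=z\psi,\ M\psi=w\psi\}$, which is the same for almost all points $(z,w)$ of the spectral curve. Under the hypotheses of the claim, it is known that every pole of $u$ has order $4$ with leading coefficient of the form $n(4n+1)(4n+3)(4n+4)$ for a (unique) positive integer $n$, so that $n_i$ is well defined; moreover, writing $\varphi_{i,m}$ for the coefficient of $(x-a_i)^m$ in the Laurent expansion of $u$ at $a_i$, one has $\varphi_{i,4k-l}=0$ for $k=0,\dots,n_i$, $l=1,2,3$. *)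

theory Defs
  imports "HOL-Complex_Analysis.Complex_Analysis"
begin

(* The list [c_0, ..., c_m] stands for the operator c_0 + c_1 d + ... + c_m d^m. *)
type_synonym diffop = "(complex \<Rightarrow> complex) list"

definition apply_op :: "diffop \<Rightarrow> (complex \<Rightarrow> complex) \<Rightarrow> complex \<Rightarrow> complex" where
  "apply_op P f z = (\<Sum>j<length P. (P ! j) z * (deriv ^^ j) f z)"

(* HOL functions that are meromorphic_on a set may take arbitrary values on a sparse set,
   so "the leading coefficient is not identically zero" is stated modulo sparse sets. *)
definition diffop_of_order :: "nat \<Rightarrow> diffop \<Rightarrow> bool" where
  "diffop_of_order m P \<longleftrightarrow>
     length P = Suc m \<and> (\<forall>c\<in>set P. c meromorphic_on UNIV) \<and>
     \<not> eventually (\<lambda>z. (P ! m) z = 0) (cosparse UNIV)"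

(* U consists of ordinary points of P. *)
definition ordinary_on :: "diffop \<Rightarrow> complex set \<Rightarrow> bool" where
  "ordinary_on P U \<longleftrightarrow>
     open U \<and> (\<forall>c\<in>set P. c analytic_on U) \<and> (\<forall>z\<in>U. last P z \<noteq> 0)"

definition ops_commute :: "diffop \<Rightarrow> diffop \<Rightarrow> bool" where
  "ops_commute P Q \<longleftrightarrow>
     (\<forall>U f. ordinary_on P U \<and> ordinary_on Q U \<and> f holomorphic_on U \<longrightarrow>
        (\<forall>z\<in>U. apply_op P (apply_op Q f) z = apply_op Q (apply_op P f) z))"

definition eigenfunctions :: "diffop \<Rightarrow> complex \<Rightarrow> complex set \<Rightarrow> (complex \<Rightarrow> complex) set" where
  "eigenfunctions P lam U = {f. f holomorphic_on U \<and> (\<forall>z\<in>U. apply_op P f z = lam * f z)}"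

(* The functions psi i (i in I, I finite) form a basis of the complex vector space S of
   functions on U; functions are identified if they agree on U. *)
definition basis_on ::
  "complex set \<Rightarrow> (complex \<Rightarrow> complex) set \<Rightarrow> nat set \<Rightarrow> (nat \<Rightarrow> complex \<Rightarrow> complex) \<Rightarrow> bool" where
  "basis_on U S I \<psi> \<longleftrightarrow>
     finite I \<and> (\<forall>i\<in>I. \<psi> i \<in> S) \<and>
     (\<forall>c. (\<forall>z\<in>U. (\<Sum>i\<in>I. c i * \<psi> i z) = 0) \<longrightarrow> (\<forall>i\<in>I. c i = 0)) \<and>
     (\<forall>f\<in>S. \<exists>c. \<forall>z\<in>U. f z = (\<Sum>i\<in>I. c i * \<psi> i z))"

(* R is regarded as a polynomial in w whose coefficients are polynomials in z; the relation
   says R(P,Q) = 0, with z replaced by P and w by Q. *)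
definition poly_relation :: "complex poly poly \<Rightarrow> diffop \<Rightarrow> diffop \<Rightarrow> bool" where
  "poly_relation R P Q \<longleftrightarrow>
     (\<forall>U f. ordinary_on P U \<and> ordinary_on Q U \<and> f holomorphic_on U \<longrightarrow>
        (\<forall>z\<in>U. (\<Sum>i\<le>degree R. \<Sum>j\<le>degree (coeff R i).
            coeff (coeff R i) j * (apply_op P ^^ j) ((apply_op Q ^^ i) f) z) = 0))"

(* The common eigenfunctions are multivalued in general; their space has its dimension measured
   on discs of ordinary points, where the branches are single-valued.  "Almost all points" of
   the curve R = 0 means all but finitely many.  R need not be required to be irreducible: a
   superfluous factor would contribute infinitely many points without eigenfunctions,
   so that no r would qualify. *)
definition has_rank :: "diffop \<Rightarrow> diffop \<Rightarrow> nat \<Rightarrow> bool" where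
  "has_rank P Q r \<longleftrightarrow>
     (\<exists>R. R \<noteq> 0 \<and> poly_relation R P Q \<and>
        finite {(z, w). poly (poly R [:w:]) z = 0 \<and>
          \<not> (\<forall>p e. e > 0 \<and> ordinary_on P (ball p e) \<and> ordinary_on Q (ball p e) \<longrightarrow>
               (\<exists>\<psi>. basis_on (ball p e)
                  (eigenfunctions P z (ball p e) \<inter> eigenfunctions Q w (ball p e)) {..<r} \<psi>))})"

(* The germ of f at the start of the path is continued to the germ of g at its end; F t is a
   representative of the germ at time t. *)
definition continues_along ::
  "(real \<Rightarrow> complex) \<Rightarrow> (complex \<Rightarrow> complex) \<Rightarrow> (complex \<Rightarrow> complex) \<Rightarrow> bool" where
  "continues_along \<gamma> f g \<longleftrightarrow> path \<gamma> \<and>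
     (\<exists>F. (\<forall>t\<in>{0..1}. F t analytic_on {\<gamma> t} \<and>
             (\<forall>\<^sub>F s in at t within {0..1}. \<forall>\<^sub>F z in nhds (\<gamma> s). F s z = F t z)) \<and>
          (\<forall>\<^sub>F z in nhds (pathstart \<gamma>). F 0 z = f z) \<and>
          (\<forall>\<^sub>F z in nhds (pathfinish \<gamma>). F 1 z = g z))"

(* The germ of f at p can be continued to a point near a, from there along all paths in a
   punctured disc of radius r about a, and going once around a changes its value.  The
   continuation in the punctured disc is given as a holomorphic function Phi on the universal
   cover, which is the half-plane Re s < ln r with covering map s |-> a + exp s. *)
definition has_branch_point :: "(complex \<Rightarrow> complex) \<Rightarrow> complex \<Rightarrow> complex \<Rightarrow> bool" where
  "has_branch_point f p a \<longleftrightarrow>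
     (\<exists>r>0. \<exists>\<Phi> s\<^sub>0 \<gamma> g.
        \<Phi> holomorphic_on {s. Re s < ln r} \<and> Re s\<^sub>0 < ln r \<and>
        pathstart \<gamma> = p \<and> pathfinish \<gamma> = a + exp s\<^sub>0 \<and> continues_along \<gamma> f g \<and>
        (\<forall>\<^sub>F s in nhds s\<^sub>0. \<Phi> s = g (a + exp s)) \<and>
        (\<exists>s. Re s < ln r \<and> \<Phi> (s + 2 * of_real pi * \<i>) \<noteq> \<Phi> s))"

definition L4 :: "(complex \<Rightarrow> complex) \<Rightarrow> diffop" where
  "L4 u = [u, \<lambda>_. 0, \<lambda>_. 0, \<lambda>_. 0, \<lambda>_. 1]"

(* Near a the equation L4 u psi = lam psi has a fundamental system
   (x - a) powr (sigma r) * G r x, r = 1..4, with all G r holomorphic at a.  The multivalued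
   power is exp (sigma r * l x), for an arbitrary branch l of log (x - a) on a domain U. *)
definition has_fundamental_system ::
  "(complex \<Rightarrow> complex) \<Rightarrow> complex \<Rightarrow> complex \<Rightarrow> (nat \<Rightarrow> complex) \<Rightarrow> bool" where
  "has_fundamental_system u lam a \<sigma> \<longleftrightarrow>
     (\<exists>\<rho>>0. \<exists>G. u analytic_on (ball a \<rho> - {a}) \<and>
        (\<forall>r\<in>{1..4::nat}. G r holomorphic_on ball a \<rho>) \<and>
        (\<forall>U l. open U \<and> connected U \<and> U \<noteq> {} \<and> U \<subseteq> ball a \<rho> - {a} \<and>
               l holomorphic_on U \<and> (\<forall>x\<in>U. exp (l x) = x - a) \<longrightarrow>
           basis_on U (eigenfunctions (L4 u) lam U) {1..4} (\<lambda>r x. exp (\<sigma> r * l x) * G r x)))"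

end

theory Submission
  imports Defs "HOL-Computational_Algebra.Fundamental_Theorem_Algebra"
begin

text \<open>
  Let x be a local coordinate at the pole a. A differential operator N of order m with
  meromorphic coefficients acts on powers by N x^s = (sum over w of nu_w(s) x^(s+w)), where the
  integers w are bounded below and every nu_w is a polynomial of degree at most m. For d^4 + u
  these polynomials are the Laurent coefficients phi_w of u, except that s(s-1)(s-2)(s-3) is added
  at w = -4. Hence N commutes with d^4 + u only if, for every w, one polynomial identity holds
  that relates the nu_w to their shifts; it is the axiom of the locale commuting_symbols. The
  coefficient phi_0 cancels from it, so replacing u by u - lam changes nothing. All local
  information about u comes from these identities.

  The pole has order at most 4 (pole_order_le_4): if the order p were larger, then with respect
  to the weight (p - 4) deg - 4 w the part of N of maximal weight would satisfy a two-term
  recurrence that links degree e to degree e - 4. It starts at the leading term of N and can only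
  stop at degree 0, which forces m to be divisible by 4; but M has order 4g + 2.

  So a is a regular singular point with indicial polynomial
  Q(s) = s(s-1)(s-2)(s-3) + phi_(-4). The lowest symbol of N is P = nu_(-m), and the lowest
  identity reads Q(s - m) P(s) = P(s - 4) Q(s). The roots of Q are the four exponents: two pairs,
  each with difference K = 4n + 2, and the pairs differ by a number that is not real. If m were
  odd, the lowest identity would make P vanish at tau + 4k for every k, where tau is a root of Q;
  so no operator of odd order commutes with d^4 + u (order_even).

  The heart is the absence of logarithms (no_logarithms). In a pair tau, tau + K, only the smaller
  exponent can be resonant. Suppose that the Frobenius recursion at tau cannot be solved. Then all
  series with exponents in tau + Z that are killed by some power of d^4 + u - lam have a leading
  exponent of the form tau + K + 4i with a natural number i. Such series exist for every i, M maps
  them to such series, and M lowers their leading exponent by 4g + 2 whenever P does not vanish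
  there. This contradicts the form of the leading exponents, as 4g + 2 is not divisible by 4.

  It remains to pass from formal series to functions. The Frobenius series converge, and the four
  solutions are independent because the pairs of exponents differ by a non-integer; a fourth order
  equation has at most four independent solutions, so they span. Finally, every solution can be
  continued along a path in the complement of the singularities of u to a neighbourhood of a, and
  there it is a combination of the four powers. No exponent is an integer, so the monodromy
  around a has no eigenvalue 1 and a nonzero solution is never single-valued.
\<close>

section \<open>Leading coefficients of shifted polynomials\<close>

definition quartic :: "complex poly" where "quartic = [:0, -6, 11, -6, 1:]"

lemma poly_quartic: "poly quartic s = s * (s - 1) * (s - 2) * (s - 3)"
  by (simp add: quartic_def algebra_simps)

lemma coeff_shift:
  fixes p :: "complex poly"
  shows "(degree p \<le> d \<longrightarrow> coeff (pcompose p [:h, 1:]) d = coeff p d) \<and>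
         (degree p \<le> Suc d \<longrightarrow>
           coeff (pcompose p [:h, 1:]) d = coeff p d + of_nat (Suc d) * h * coeff p (Suc d))"
proof (induction p arbitrary: d)
  case 0
  then show ?case by simp
next
  case (pCons c p)
  show ?case
  proof (cases d)
    case 0
    have "coeff (pcompose p [:h, 1:]) 0 = coeff p 0" if "degree p = 0"
      using pCons.IH[of 0] that by simp
    then show ?thesis using 0 by (auto simp: pcompose_pCons coeff_pCons split: if_splits)
  next
    case (Suc e)
    have d0: "degree p \<le> e" if "degree (pCons c p) \<le> Suc e" for e
      using that by (auto split: if_splits)
    show ?thesis
    proof (intro conjI impI)
      assume "degree (pCons c p) \<le> d"
      then have "degree p \<le> e" using Suc d0 by simp
      moreover from this have "coeff p (Suc e) = 0" by (simp add: coeff_eq_0)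
      ultimately show "coeff (pcompose (pCons c p) [:h, 1:]) d = coeff (pCons c p) d"
        using pCons.IH[of e] pCons.IH[of "Suc e"] Suc by (simp add: pcompose_pCons coeff_pCons)
    next
      assume "degree (pCons c p) \<le> Suc d"
      then have "degree p \<le> Suc e" using Suc d0 by simp
      then show "coeff (pcompose (pCons c p) [:h, 1:]) d
          = coeff (pCons c p) d + of_nat (Suc d) * h * coeff (pCons c p) (Suc d)"
        using pCons.IH[of e] pCons.IH[of "Suc e"] Suc
        by (simp add: pcompose_pCons coeff_pCons algebra_simps)
    qed
  qed
qed

lemma coeff_shift_diff_high:
  fixes p :: "complex poly"
  assumes "degree p \<le> d" "d \<le> e"
  shows "coeff (p - pcompose p [:h, 1:]) e = 0"
proof -
  have "degree p \<le> e" using assms by simp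
  then show ?thesis using coeff_shift[of p e h] by simp
qed

lemma coeff_shift_diff:
  fixes p :: "complex poly"
  assumes "degree p \<le> Suc d"
  shows "coeff (p - pcompose p [:h, 1:]) d = - of_nat (Suc d) * h * coeff p (Suc d)"
  using coeff_shift[of p d h] assms by (simp add: algebra_simps)

text \<open>
  The products agree up to the effect of the two shifts: (s + h)^4 contributes 4h, and the
  difference of p(s) and p(s - 4) contributes 4d.
\<close>
lemma coeff_quartic_commutator:
  fixes p :: "complex poly"
  assumes "degree p \<le> d"
  shows "coeff (pcompose quartic [:h, 1:] * p - quartic * pcompose p [:-4, 1:]) (d + 3)
    = 4 * (h + of_nat d) * coeff p d"
proof -
  define q where "q = pcompose p [:-4, 1:]"
  have q: "coeff q e = 0" if "e > d" for e
  proof -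
    have "degree p \<le> e" using assms that by simp
    then have "coeff q e = coeff p e" using coeff_shift[of p e "-4"] unfolding q_def by blast
    then show ?thesis using assms that by (simp add: coeff_eq_0)
  qed
  have p: "coeff p e = 0" if "e > d" for e using assms that by (simp add: coeff_eq_0)
  have qd: "coeff q d = coeff p d" using coeff_shift[of p d "-4"] assms unfolding q_def by blast
  have ex: "\<exists>a b c. pcompose quartic [:h, 1:] = [:a, b, c, 4*h - 6, 1:]"
    unfolding quartic_def by (simp add: pcompose_pCons)
  then obtain a b c where s: "pcompose quartic [:h, 1:] = [:a, b, c, 4*h - 6, 1:]" by blast
  show ?thesis
  proof (cases d)
    case 0
    then show ?thesis unfolding s q_def[symmetric] unfolding quartic_def
      using p q qd by (simp add: numeral_eq_Suc coeff_pCons algebra_simps)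
  next
    case (Suc e)
    have "coeff q e = coeff p e - 4 * of_nat d * coeff p d"
      using coeff_shift[of p e "-4"] assms Suc unfolding q_def by (simp add: algebra_simps)
    then show ?thesis unfolding s q_def[symmetric] unfolding quartic_def
      using p q qd Suc by (simp add: numeral_eq_Suc coeff_pCons algebra_simps)
  qed
qed

section \<open>Symbols of operators that commute with a fourth order operator\<close>

text \<open>
  The Laurent coefficients of u and the symbol of a commuting operator of order m. The axiom
  commutation is the coefficient of x^(s + w - 4) in the commutator applied to x^s; the index is
  chosen so that the contribution of d^4 involves only one polynomial, the one at w.
  The bounds B and D keep the sum finite.
\<close>
locale commuting_symbols =
  fixes \<phi> :: "int \<Rightarrow> complex" and \<nu> :: "int \<Rightarrow> complex poly" and m B D :: nat
  assumes phi_low: "i < - int B \<Longrightarrow> \<phi> i = 0"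
    and nu_low: "w < - int D \<Longrightarrow> \<nu> w = 0"
    and deg_nu: "degree (\<nu> w) \<le> m"
    and lead_nonzero: "\<exists>w. coeff (\<nu> w) m \<noteq> 0"
    and commutation: "pcompose quartic [:of_int w, 1:] * \<nu> w - quartic * pcompose (\<nu> w) [:-4, 1:]
      + (\<Sum>i = - int B..w - 4 + int D.
          smult (\<phi> i) (\<nu> (w - 4 - i) - pcompose (\<nu> (w - 4 - i)) [:of_int i, 1:])) = 0"
begin

text \<open>
  The coefficient of s^(m+3) sees only the commutator with d^4, because every other term has
  degree less than m. In terms of the operator: its leading coefficient has derivative zero.
\<close>
lemma leading_coefficient_constant:
  assumes "w \<noteq> - int m"
  shows "coeff (\<nu> w) m = 0"
proof -
  have "4 * (of_int w + of_nat m) * coeff (\<nu> w) m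
    + (\<Sum>i = - int B..w - 4 + int D. coeff (smult (\<phi> i)
        (\<nu> (w - 4 - i) - pcompose (\<nu> (w - 4 - i)) [:of_int i, 1:])) (m + 3)) = 0"
    using arg_cong[OF commutation[of w], of "\<lambda>p. coeff p (m + 3)"]
    by (simp only: coeff_add coeff_0 coeff_sum coeff_quartic_commutator[OF deg_nu])
  moreover have "(\<Sum>i = - int B..w - 4 + int D. coeff (smult (\<phi> i)
        (\<nu> (w - 4 - i) - pcompose (\<nu> (w - 4 - i)) [:of_int i, 1:])) (m + 3)) = 0"
    by (intro sum.neutral ballI) (simp only: coeff_smult, simp only: coeff_shift_diff_high[OF deg_nu le_add1] mult_zero_right)
  ultimately have "4 * (of_int w + of_nat m) * coeff (\<nu> w) m = (0::complex)"
    by (simp only: add_0_right)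
  then have "(of_int w + of_nat m) * coeff (\<nu> w) m = (0::complex)"
    by (simp only: mult.assoc mult_eq_0_iff zero_neq_numeral[symmetric] simp_thms)
  moreover have "of_int w + of_nat m \<noteq> (0::complex)"
    using assms by (metis add.commute add_eq_0_iff of_int_add of_int_eq_0_iff of_int_of_nat_eq)
  ultimately show ?thesis by simp
qed

lemma leading_coefficient_nonzero: "coeff (\<nu> (- int m)) m \<noteq> 0"
  using leading_coefficient_constant lead_nonzero by metis

text \<open>
  The weight of the monomial s^d in the w-th polynomial is (p - 4) d - 4 w, where p is the pole
  order. It is chosen so that d^4 and the leading term of u both have weight 4p, while commutators
  lose exactly p - 4. So at maximal weight W the identity involves only the commutators with these
  two terms, which gives the two-term recurrence called edge below.
\<close>
lemma pole_order_le_4: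
  assumes "\<not> 4 dvd m" "i < -4"
  shows "\<phi> i = 0"
proof (rule ccontr)
  assume "\<phi> i \<noteq> 0"
  define p where "p = Max {p. p \<le> B \<and> \<phi> (- int p) \<noteq> 0}"
  let ?S = "{p. p \<le> B \<and> \<phi> (- int p) \<noteq> 0}"
  have fS: "finite ?S" by simp
  have iS: "nat (- i) \<in> ?S" using \<open>\<phi> i \<noteq> 0\<close> assms(2) phi_low[of i] by force
  have pS: "p \<in> ?S" unfolding p_def using Max_in[OF fS] iS by blast
  have p5: "p \<ge> 5" using Max_ge[OF fS iS] assms(2) unfolding p_def by linarith
  have phi0: "\<phi> j = 0" if "j < - int p" for j
  proof (rule ccontr)
    assume "\<phi> j \<noteq> 0"
    then have "nat (- j) \<in> ?S" using that phi_low[of j] by force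
    then show False using Max_ge[OF fS, of "nat (-j)"] that unfolding p_def by linarith
  qed
  define wt where "wt = (\<lambda>w (d::nat). (int p - 4) * int d - 4 * w)"
  \<comment> \<open>The set of weights is bounded above because degrees are at most m and w is at least - D.\<close>
  define T where "T = {wt w d | w d. coeff (\<nu> w) d \<noteq> 0}"
  define U where "U = (int p - 4) * int m + 4 * int D"
  have Tbd: "x \<le> U" if "x \<in> T" for x
  proof -
    from that obtain w d where x: "x = wt w d" and c: "coeff (\<nu> w) d \<noteq> 0" unfolding T_def by blast
    have "d \<le> m" using c deg_nu[of w] le_degree le_trans by blast
    moreover have "w \<ge> - int D" using c nu_low[of w] by force
    moreover have "(int p - 4) * int d \<le> (int p - 4) * int m"
      using p5 \<open>d \<le> m\<close> by (intro mult_left_mono) auto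
    ultimately show ?thesis unfolding x wt_def U_def by linarith
  qed
  have T0: "int p * int m \<in> T"
    unfolding T_def wt_def using leading_coefficient_nonzero
    by (intro CollectI exI[of _ "- int m"] exI[of _ m]) (auto simp: algebra_simps)
  define W where "W = Max {x \<in> T. int p * int m \<le> x}"
  have fT: "finite {x \<in> T. int p * int m \<le> x}"
    by (rule finite_subset[of _ "{int p * int m..U}"]) (use Tbd in auto)
  have WT: "W \<in> T" "int p * int m \<le> W"
    using Max_in[OF fT] T0 unfolding W_def by blast+
  have Wmax: "x \<le> W" if "x \<in> T" for x
  proof (cases "int p * int m \<le> x")
    case True
    then show ?thesis using Max_ge[OF fT, of x] that unfolding W_def by blast
  next
    case False
    then show ?thesis using WT by linarith
  qed
  have wtW: "coeff (\<nu> w) d = 0" if "wt w d > W" for w d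
    using Wmax[of "wt w d"] that unfolding T_def by force
  have degW: "degree (\<nu> w) \<le> d" if "W < wt w (Suc d)" for w d
  proof (rule degree_le, intro allI impI)
    fix k assume "d < k"
    have "wt w (Suc d) \<le> wt w k"
      unfolding wt_def using p5 \<open>d < k\<close> by (simp add: mult_left_mono)
    then show "coeff (\<nu> w) k = 0" using wtW[of w k] that by linarith
  qed
  \<comment> \<open>The coefficient of s^e, from the commutator with d^4 at w - p + 4 and the one with the
    leading term of u at w. If e + 1 < 4, then maximality of W makes the former vanish.\<close>
  have edge: "of_nat p * of_nat (Suc e) * \<phi> (- int p) * coeff (\<nu> w) (Suc e) +
      (if Suc e \<ge> 4 then 4 * (of_int (w - int p + 4) + of_nat (Suc e - 4)) *
          coeff (\<nu> (w - int p + 4)) (Suc e - 4) else 0) = 0"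
    if W: "wt w (Suc e) = W" and nz: "w \<ge> - int D" for w e
  proof -
    let ?w = "w - int p + 4"
    let ?t = "\<lambda>i. smult (\<phi> i) (\<nu> (?w - 4 - i) - pcompose (\<nu> (?w - 4 - i)) [:of_int i, 1:])"
    have 1: "coeff (pcompose quartic [:of_int ?w, 1:] * \<nu> ?w - quartic * pcompose (\<nu> ?w) [:-4, 1:]) e
        + (\<Sum>i = - int B..?w - 4 + int D. coeff (?t i) e) = 0"
      using arg_cong[OF commutation[of ?w], of "\<lambda>p. coeff p e"]
      by (simp only: coeff_add coeff_0 coeff_sum)
    have 2: "coeff (?t i) e = 0" if "i \<noteq> - int p" for i
    proof (cases "i < - int p")
      case True
      then show ?thesis using phi0 by simp
    next
      case False
      then have "wt (?w - 4 - i) (Suc e) > W"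
        using W that unfolding wt_def by simp
      then have "degree (\<nu> (?w - 4 - i)) \<le> e" by (rule degW)
      then show ?thesis using coeff_shift_diff_high[of "\<nu> (?w - 4 - i)" e e "of_int i"] by simp
    qed
    have "degree (\<nu> w) \<le> Suc e"
      by (rule degW) (use W p5 in \<open>simp add: wt_def algebra_simps\<close>)
    then have 3: "coeff (?t (- int p)) e = of_nat p * of_nat (Suc e) * \<phi> (- int p) * coeff (\<nu> w) (Suc e)"
      using coeff_shift_diff[of "\<nu> w" e "of_int (- int p)"] by (simp del: of_nat_Suc)
    have "(\<Sum>i = - int B..?w - 4 + int D. coeff (?t i) e) = (\<Sum>i \<in> {- int p}. coeff (?t i) e)"
      using 2 nz pS by (intro sum.mono_neutral_right) auto
    then have 4: "(\<Sum>i = - int B..?w - 4 + int D. coeff (?t i) e)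
        = of_nat p * of_nat (Suc e) * \<phi> (- int p) * coeff (\<nu> w) (Suc e)"
      using 3 by simp
    have 5: "coeff (pcompose quartic [:of_int ?w, 1:] * \<nu> ?w - quartic * pcompose (\<nu> ?w) [:-4, 1:]) e
      = (if Suc e \<ge> 4 then 4 * (of_int ?w + of_nat (Suc e - 4)) * coeff (\<nu> ?w) (Suc e - 4) else 0)"
    proof (cases "Suc e \<ge> 4")
      case True
      define d where "d = Suc e - 4"
      have e: "e = d + 3" using True unfolding d_def by simp
      have "degree (\<nu> ?w) \<le> d"
        by (rule degW) (use W p5 e in \<open>simp add: wt_def algebra_simps\<close>)
      from coeff_quartic_commutator[OF this, of "of_int ?w"] show ?thesis
        using True unfolding e by simp
    next
      case False
      have "\<nu> ?w = 0"
      proof (rule poly_eqI)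
        fix d
        have "(int p - 4) * int (Suc e) - (int p - 4) * 4 < (int p - 4) * int d"
        proof -
          have "int (Suc e) - 4 < int d" using False by simp
          from mult_strict_left_mono[OF this, of "int p - 4"] p5
          show ?thesis by (simp add: algebra_simps)
        qed
        then have "wt ?w d > W" unfolding W[symmetric] wt_def by simp
        then show "coeff (\<nu> ?w) d = coeff 0 d" using wtW by simp
      qed
      then show ?thesis using False by simp
    qed
    show ?thesis using 1 unfolding 4 5 by (simp only: add.commute)
  qed
  \<comment> \<open>At the largest degree d on the edge the recurrence says w = - d, so W = p d. As the leading
    term of the operator has weight p m, this forces d = m.\<close>
  have up: "\<exists>w. coeff (\<nu> w) m \<noteq> 0 \<and> wt w m = W"
  proof -
    let ?E = "{d. \<exists>w. coeff (\<nu> w) d \<noteq> 0 \<and> wt w d = W}"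
    have "?E \<subseteq> {..m}"
      using deg_nu le_degree le_trans by blast
    then have fE: "finite ?E" using finite_subset by blast
    have neE: "?E \<noteq> {}" using WT(1) unfolding T_def by blast
    define d where "d = Max ?E"
    have "d \<in> ?E" unfolding d_def using Max_in[OF fE neE] .
    then obtain w where w: "coeff (\<nu> w) d \<noteq> 0" "wt w d = W" by blast
    have wt': "wt (w + int p - 4) (Suc (d + 3)) = W" using w(2) unfolding wt_def by (simp add: algebra_simps)
    have c0: "coeff (\<nu> (w + int p - 4)) (Suc (d + 3)) = 0"
    proof (rule ccontr)
      assume "\<not> ?thesis"
      then have "Suc (d + 3) \<in> ?E" using wt' by blast
      then show False using Max_ge[OF fE] unfolding d_def by force
    qed
    have "w \<ge> - int D" using w(1) nu_low[of w] by force
    then have "4 * (of_int w + of_nat d) * coeff (\<nu> w) d = 0"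
      using edge[OF wt'] c0 p5 by simp
    then have "of_int w + of_nat d = (0::complex)"
      using w(1) by (simp only: mult.assoc mult_eq_0_iff) simp
    then have "of_int (w + int d) = (0::complex)" by simp
    then have wd: "w = - int d" unfolding of_int_eq_0_iff by simp
    have "W = int p * int d" using w(2) wd unfolding wt_def by (simp add: algebra_simps)
    then have "int p * int m \<le> int p * int d" using WT(2) by simp
    then have "m \<le> d" using p5 by (simp add: mult_le_cancel_left)
    moreover have "d \<le> m" using w(1) deg_nu le_degree le_trans by blast
    ultimately show ?thesis using w by auto
  qed
  \<comment> \<open>Downwards, a nonzero coefficient of positive degree always has a nonzero partner.\<close>
  have down: "coeff (\<nu> w) d \<noteq> 0 \<Longrightarrow> wt w d = W \<Longrightarrow> 4 dvd d" for w d
  proof (induction d arbitrary: w rule: less_induct)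
    case (less d)
    show ?case
    proof (cases d)
      case 0
      then show ?thesis by simp
    next
      case (Suc e)
      have "w \<ge> - int D" using less.prems(1) nu_low[of w] by force
      have "wt w (Suc e) = W" using less.prems(2) Suc by simp
      from edge[OF this \<open>w \<ge> - int D\<close>, folded Suc] have
        eq: "of_nat p * of_nat d * \<phi> (- int p) * coeff (\<nu> w) d +
          (if d \<ge> 4 then 4 * (of_int (w - int p + 4) + of_nat (d - 4)) *
          coeff (\<nu> (w - int p + 4)) (d - 4) else 0) = 0" .
      have nz: "of_nat p * of_nat d * \<phi> (- int p) * coeff (\<nu> w) d \<noteq> 0"
        using less.prems(1) pS p5 Suc by (simp del: of_nat_Suc)
      have d4: "d \<ge> 4" and c: "coeff (\<nu> (w - int p + 4)) (d - 4) \<noteq> 0"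
        using eq nz by (auto split: if_splits)
      have "wt (w - int p + 4) (d - 4) = W"
        using less.prems(2) d4 unfolding wt_def by (simp add: algebra_simps of_nat_diff)
      then have "4 dvd d - 4" using less.IH[OF _ c] d4 by simp
      then show ?thesis using d4 by (metis dvd_add_triv_right_iff le_add_diff_inverse2)
    qed
  qed
  show False using up down assms(1) by blast
qed

text \<open>
  At a pole of order at most 4 the lowest nonzero polynomial commutes with the Euler part of
  d^4 + u, and comparing leading coefficients gives w = - deg for its index w.
\<close>
lemma lowest_symbol:
  assumes reg: "\<And>i. i < -4 \<Longrightarrow> \<phi> i = 0" and "w < - int m"
  shows "\<nu> w = 0"
proof (rule ccontr)
  assume "\<nu> w \<noteq> 0"
  define k where "k = (LEAST k. \<nu> (int k - int D) \<noteq> 0)"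
  define w0 where "w0 = int k - int D"
  have "w \<ge> - int D" using \<open>\<nu> w \<noteq> 0\<close> nu_low[of w] by force
  then have wk: "\<nu> (int (nat (w + int D)) - int D) \<noteq> 0" using \<open>\<nu> w \<noteq> 0\<close> by simp
  have nz: "\<nu> w0 \<noteq> 0" unfolding w0_def k_def by (rule LeastI[of "\<lambda>k. \<nu> (int k - int D) \<noteq> 0", OF wk])
  have "k \<le> nat (w + int D)" unfolding k_def by (rule Least_le) (rule wk)
  then have w0w: "w0 \<le> w" using \<open>w \<ge> - int D\<close> unfolding w0_def by simp
  have low: "\<nu> v = 0" if "v < w0" for v
  proof (cases "v < - int D")
    case True
    then show ?thesis by (rule nu_low)
  next
    case False
    then show ?thesis using not_less_Least[of "nat (v + int D)" "\<lambda>k. \<nu> (int k - int D) \<noteq> 0"] that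
      unfolding w0_def k_def by force
  qed
  define d where "d = degree (\<nu> w0)"
  let ?t = "\<lambda>i. smult (\<phi> i) (\<nu> (w0 - 4 - i) - pcompose (\<nu> (w0 - 4 - i)) [:of_int i, 1:])"
  have "4 * (of_int w0 + of_nat d) * coeff (\<nu> w0) d
    + (\<Sum>i = - int B..w0 - 4 + int D. coeff (?t i) (d + 3)) = 0"
    using arg_cong[OF commutation[of w0], of "\<lambda>p. coeff p (d + 3)"]
    unfolding d_def by (simp only: coeff_add coeff_0 coeff_sum coeff_quartic_commutator[OF order_refl])
  moreover have "coeff (?t i) (d + 3) = 0" for i
  proof -
    consider "i < -4" | "i = -4" | "i > -4" by linarith
    then show ?thesis
    proof cases
      case 1 then show ?thesis using reg by simp
    next
      case 2
      then show ?thesis using coeff_shift_diff_high[of "\<nu> w0" d "d + 3" "-4"] unfolding d_def by simp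
    next
      case 3 then show ?thesis using low by simp
    qed
  qed
  ultimately have "4 * (of_int w0 + of_nat d) * coeff (\<nu> w0) d = 0"
    by (simp only: sum.neutral_const add_0_right)
  then have "of_int w0 + of_nat d = (0::complex)"
    using nz unfolding d_def by (simp only: mult.assoc mult_eq_0_iff leading_coeff_0_iff) simp
  then have "of_int (w0 + int d) = (0::complex)" by simp
  then have "w0 = - int d" unfolding of_int_eq_0_iff by simp
  moreover have "d \<le> m" unfolding d_def by (rule deg_nu)
  ultimately show False using w0w assms(2) by simp
qed

end

section \<open>Formal Frobenius series\<close>

text \<open>
  The family A stands for the operator x^s \<mapsto> (sum over k of A k s * x^(s - b + k)), and g for the
  series (sum over k of g k * x^(s + k)); act A s g lists the coefficients of the image, which
  starts at the exponent s - b. The shift b matters for compositions, where the second operator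
  has to be evaluated at the exponents of the image.
\<close>
definition act :: "(nat \<Rightarrow> complex \<Rightarrow> complex) \<Rightarrow> complex \<Rightarrow> (nat \<Rightarrow> complex) \<Rightarrow> nat \<Rightarrow> complex" where
  "act A s g k = (\<Sum>i\<le>k. A (k - i) (s + of_nat i) * g i)"

text \<open>
  The hypothesis is the equality of the two products on every single power of x; the rest is the
  associativity of convolution.
\<close>
lemma act_commute:
  assumes "\<And>k s. (\<Sum>i\<le>k. A (k - i) (s - b + of_nat i) * C i s)
                = (\<Sum>i\<le>k. C (k - i) (s - a + of_nat i) * A i s)"
  shows "act A (s - b) (act C s g) = act C (s - a) (act A s g)"
proof
  have *: "act A (s - b) (act C s g) k
      = (\<Sum>i=0..k. (\<Sum>j\<le>k - i. A (k - i - j) (s + of_nat i - b + of_nat j) * C j (s + of_nat i)) * g i)"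
    for A C :: "nat \<Rightarrow> complex \<Rightarrow> complex" and b k
  proof -
    define f where "f = (\<lambda>i r t. A t (s - b + of_nat (k - t)) * (C r (s + of_nat i) * g i))"
    have "act A (s - b) (act C s g) k = (\<Sum>j=0..k. \<Sum>i=0..j. f i (j - i) (k - j))"
      unfolding act_def f_def by (simp add: sum_distrib_left atLeast0AtMost)
    also have "\<dots> = (\<Sum>j=0..k. \<Sum>i=0..k - j. f j i (k - j - i))"
      by (rule fps_mult_assoc_lemma)
    also have "\<dots> = (\<Sum>i=0..k. (\<Sum>j\<le>k - i. A (k - i - j) (s + of_nat i - b + of_nat j) * C j (s + of_nat i)) * g i)"
      unfolding f_def sum_distrib_right atLeast0AtMost
    proof (intro sum.cong refl, goal_cases)
      case (1 i j)
      then have "k - (k - i - j) = i + j" by auto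
      then have "s - b + of_nat (k - (k - i - j)) = s + of_nat i - b + of_nat j"
        by (simp only: of_nat_add) (simp add: algebra_simps)
      then show ?case by (simp only: mult.assoc)
    qed
    finally show ?thesis .
  qed
  fix k
  show "act A (s - b) (act C s g) k = act C (s - a) (act A s g) k"
    unfolding * by (simp only: assms)
qed

text \<open>
  The initial exponent drops by 4 in every step because the lowest weight of d^4 + u is -4.
\<close>
primrec act_pow :: "(nat \<Rightarrow> complex \<Rightarrow> complex) \<Rightarrow> nat \<Rightarrow> complex \<Rightarrow> (nat \<Rightarrow> complex) \<Rightarrow> nat \<Rightarrow> complex" where
  "act_pow A 0 s g = g"
| "act_pow A (Suc j) s g = act_pow A j (s - 4) (act A s g)"

lemma act_zero [simp]: "act A s (\<lambda>_. 0) = (\<lambda>_. 0)"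
  unfolding act_def by simp

lemma act_pow_commute:
  assumes "\<And>k s. (\<Sum>i\<le>k. A (k - i) (s - b + of_nat i) * C i s)
                = (\<Sum>i\<le>k. C (k - i) (s - 4 + of_nat i) * A i s)"
  shows "act_pow A j (s - b) (act C s g) = act C (s - 4 * of_nat j) (act_pow A j s g)"
proof (induction j arbitrary: s g)
  case 0
  then show ?case by simp
next
  case (Suc j)
  have "act_pow A (Suc j) (s - b) (act C s g) = act_pow A j (s - 4 - b) (act C (s - 4) (act A s g))"
    using act_commute[of A b C 4 s g, OF assms] by (simp add: algebra_simps)
  also have "\<dots> = act C (s - 4 * of_nat (Suc j)) (act_pow A (Suc j) s g)"
    unfolding Suc.IH by (simp add: algebra_simps)
  finally show ?case .
qed

text \<open>
  The symbol of x^(-4) (Q(x d) + v 1 x + v 2 x^2 + ...); the term of index 0 is Q itself.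
\<close>
definition euler_symbol :: "(complex \<Rightarrow> complex) \<Rightarrow> (nat \<Rightarrow> complex) \<Rightarrow> nat \<Rightarrow> complex \<Rightarrow> complex" where
  "euler_symbol Q v k s = (if k = 0 then Q s else v k)"

lemma act_euler_symbol:
  "act (euler_symbol Q v) s g k = Q (s + of_nat k) * g k + (\<Sum>i<k. v (k - i) * g i)"
  by (simp add: act_def euler_symbol_def lessThan_Suc_atMost[symmetric] sum.lessThan_Suc)

context
  fixes g0 e :: "nat \<Rightarrow> complex" and Q :: "complex \<Rightarrow> complex" and v :: "nat \<Rightarrow> complex"
    and s :: complex and N :: nat
begin

function frobenius_coeff :: "nat \<Rightarrow> complex" where
  "frobenius_coeff k = (if k \<le> N then g0 k
     else (e k - (\<Sum>i\<in>{..<k}. v (k - i) * frobenius_coeff i)) / Q (s + of_nat k))"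
  by auto
termination by (relation "Wellfounded.measure id") auto

declare frobenius_coeff.simps [simp del]

text \<open>
  Beyond the last resonance N the recursion determines all coefficients, whatever the coefficients
  up to N are.
\<close>
lemma frobenius_coeff_solves:
  assumes "\<And>k. k > N \<Longrightarrow> Q (s + of_nat k) \<noteq> 0"
  shows "\<exists>g. (\<forall>k\<le>N. g k = g0 k) \<and> (\<forall>k>N. act (euler_symbol Q v) s g k = e k)"
proof (intro exI[of _ frobenius_coeff] conjI allI impI)
  fix k assume "k \<le> N"
  then show "frobenius_coeff k = g0 k" by (simp add: frobenius_coeff.simps)
next
  fix k assume "N < k"
  then show "act (euler_symbol Q v) s frobenius_coeff k = e k"
    using assms[of k] unfolding act_euler_symbol
    by (subst frobenius_coeff.simps) simp
qed

end

text \<open>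
  Applying the operator lowers the leading exponent by 4, unless this exponent is a root of Q. The
  upper root is the asserted form. At the lower root the obstruction says that the
  image e has a nonzero coefficient of index at most K beyond that root; so its leading exponent is
  at most \<tau> + K - 4, too low for the form required by the induction hypothesis.
\<close>
lemma leading_exponent_of_generalized_kernel:
  assumes roots: "\<And>z::int. Q (\<tau> + of_int z) = 0 \<Longrightarrow> z = 0 \<or> z = int K"
    and obstructed: "\<And>f. f 0 \<noteq> 0 \<Longrightarrow> \<exists>k\<le>K. act (euler_symbol Q v) \<tau> f k \<noteq> 0"
    and "act_pow (euler_symbol Q v) j s g = (\<lambda>_. 0)"
    and "\<And>i. i < k0 \<Longrightarrow> g i = 0" "g k0 \<noteq> 0" "s + of_nat k0 = \<tau> + of_int z"
  shows "\<exists>i. z = int K + 4 * int i"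
  using assms(3-)
proof (induction j arbitrary: s g k0 z)
  case 0
  then show ?case by (metis act_pow.simps(1))
next
  case (Suc j)
  define e where "e = act (euler_symbol Q v) s g"
  have pow: "act_pow (euler_symbol Q v) j (s - 4) e = (\<lambda>_. 0)"
    using Suc.prems(1) unfolding e_def by simp
  have e_low: "e i = 0" if "i < k0" for i
    unfolding e_def act_def using Suc.prems(2) that by (intro sum.neutral) auto
  have e_k0: "e k0 = Q (s + of_nat k0) * g k0"
    unfolding e_def act_euler_symbol using Suc.prems(2) by simp
  show ?case
  proof (cases "Q (s + of_nat k0) = 0")
    case False
    have "\<exists>i. z - 4 = int K + 4 * int i"
      by (rule Suc.IH[OF pow e_low]) (use False e_k0 Suc.prems in \<open>auto simp: algebra_simps\<close>)
    then obtain i where "z - 4 = int K + 4 * int i" by blast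
    then show ?thesis by (intro exI[of _ "Suc i"]) simp
  next
    case True
    then consider "z = int K" | "z = 0" using roots[of z] Suc.prems(4) by auto
    then show ?thesis
    proof cases
      case 1
      then show ?thesis by (intro exI[of _ 0]) simp
    next
      case 2
      have shift: "act (euler_symbol Q v) \<tau> (\<lambda>i. g (k0 + i)) k = e (k0 + k)" for k
      proof -
        have "s + of_nat k0 = \<tau>" using Suc.prems(4) 2 by simp
        then have Q: "Q (s + of_nat (k0 + k)) = Q (\<tau> + of_nat k)" by (simp flip: add.assoc)
        have "(\<Sum>i<k0 + k. v (k0 + k - i) * g i) = (\<Sum>i\<in>{k0..<k0 + k}. v (k0 + k - i) * g i)"
          using Suc.prems(2) by (intro sum.mono_neutral_right) auto
        also have "\<dots> = (\<Sum>i<k. v (k - i) * g (k0 + i))"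
          by (rule sum.reindex_bij_witness[of _ "\<lambda>i. k0 + i" "\<lambda>i. i - k0"]) (auto simp: add.commute)
        finally show ?thesis unfolding e_def act_euler_symbol Q by simp
      qed
      obtain k where k: "k \<le> K" "e (k0 + k) \<noteq> 0"
        using obstructed[of "\<lambda>i. g (k0 + i)"] Suc.prems(3) unfolding shift by auto
      define k1 where "k1 = (LEAST i. e i \<noteq> 0)"
      have k1: "e k1 \<noteq> 0" unfolding k1_def by (rule LeastI[of "\<lambda>i. e i \<noteq> 0", OF k(2)])
      have k1_min: "e i = 0" if "i < k1" for i using not_less_Least that unfolding k1_def by blast
      have "k1 \<le> k0 + k" unfolding k1_def by (rule Least_le) (rule k(2))
      have "s + of_nat k0 = \<tau>" using Suc.prems(4) 2 by simp
      then have "s - 4 + of_nat k1 = \<tau> + of_int (int k1 - int k0 - 4)" by (auto simp: algebra_simps)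
      from Suc.IH[OF pow k1_min k1 this] obtain i where "int k1 - int k0 - 4 = int K + 4 * int i" by blast
      then show ?thesis using \<open>k1 \<le> k0 + k\<close> k(1) by linarith
    qed
  qed
qed

text \<open>
  Above the upper root the recursion is never resonant, so preimages can be taken one after
  another.
\<close>
lemma generalized_kernel_exists:
  assumes "Q s = 0" "\<And>k. k > 0 \<Longrightarrow> Q (s + of_nat k) \<noteq> 0"
  shows "\<exists>h. h 0 \<noteq> 0 \<and> act_pow (euler_symbol Q v) (Suc j) (s + 4 * of_nat j) h = (\<lambda>_. 0)"
proof (induction j)
  case 0
  obtain g where g: "g 0 = 1" "\<And>k. k > 0 \<Longrightarrow> act (euler_symbol Q v) s g k = 0"
    using frobenius_coeff_solves[of 0 Q s "\<lambda>_. 1" v "\<lambda>_. 0"] assms(2) by auto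
  moreover have "act (euler_symbol Q v) s g 0 = 0"
    unfolding act_euler_symbol using assms(1) by simp
  ultimately have "act (euler_symbol Q v) s g = (\<lambda>_. 0)" by (metis neq0_conv)
  then show ?case using g(1) by (intro exI[of _ g]) simp
next
  case (Suc j)
  then obtain h where h: "h 0 \<noteq> 0" "act_pow (euler_symbol Q v) (Suc j) (s + 4 * of_nat j) h = (\<lambda>_. 0)" by blast
  let ?s = "s + 4 * of_nat (Suc j)"
  have nz: "Q (?s + of_nat k) \<noteq> 0" for k
    using assms(2)[of "4 * Suc j + k"] by (simp add: algebra_simps)
  obtain g where g: "g 0 = h 0 / Q ?s" "\<And>k. k > 0 \<Longrightarrow> act (euler_symbol Q v) ?s g k = h k"
    using frobenius_coeff_solves[of 0 Q ?s "\<lambda>_. h 0 / Q ?s" v h] nz by auto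
  have "act (euler_symbol Q v) ?s g 0 = h 0"
    unfolding act_euler_symbol using g(1) nz[of 0] by simp
  then have "act (euler_symbol Q v) ?s g = h" using g(2) by (metis ext neq0_conv)
  moreover have "?s - 4 = s + 4 * of_nat j" by simp
  ultimately have "act_pow (euler_symbol Q v) (Suc (Suc j)) ?s g = (\<lambda>_. 0)"
    using h(2) by (simp del: act_pow.simps(2) add: act_pow.simps(2)[of _ "Suc j"])
  moreover have "g 0 \<noteq> 0" using g(1) h(1) nz[of 0] by simp
  ultimately show ?case by blast
qed

text \<open>
  If the recursion at the lower root were obstructed, applying the commuting operator to a
  generalized solution with leading exponent \<tau> + K + 4j would give a generalized solution whose
  leading exponent is smaller by m. The previous two lemmas then force 4 to divide m.
\<close>
theorem no_logarithms:
  assumes root: "Q (\<tau> + of_nat K) = 0"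
    and roots: "\<And>z::int. Q (\<tau> + of_int z) = 0 \<Longrightarrow> z = 0 \<or> z = int K"
    and root0: "Q \<tau> = 0"
    and commute: "\<And>k s. (\<Sum>i\<le>k. euler_symbol Q v (k - i) (s - of_nat m + of_nat i) * \<mu> i s)
          = (\<Sum>i\<le>k. \<mu> (k - i) (s - 4 + of_nat i) * euler_symbol Q v i s)"
    and "\<not> 4 dvd m"
    and nz: "\<mu> 0 (\<tau> + of_nat K + 4 * of_nat j) \<noteq> 0"
  shows "\<exists>f. f 0 \<noteq> 0 \<and> (\<forall>k. act (euler_symbol Q v) \<tau> f k = 0)"
proof (rule ccontr)
  assume contra: "\<not> ?thesis"
  have obstructed: "\<exists>k\<le>K. act (euler_symbol Q v) \<tau> f k \<noteq> 0" if "f 0 \<noteq> 0" for f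
  proof (rule ccontr)
    assume *: "\<not> ?thesis"
    have "Q (\<tau> + of_nat k) \<noteq> 0" if "K < k" for k
      using roots[of "int k"] that by auto
    then obtain g where g: "\<And>k. k \<le> K \<Longrightarrow> g k = f k" "\<And>k. k > K \<Longrightarrow> act (euler_symbol Q v) \<tau> g k = 0"
      using frobenius_coeff_solves[of K Q \<tau> f v "\<lambda>_. 0"] by blast
    have "act (euler_symbol Q v) \<tau> g k = 0" for k
    proof (cases "k \<le> K")
      case True
      then have "act (euler_symbol Q v) \<tau> g k = act (euler_symbol Q v) \<tau> f k"
        unfolding act_def using g(1) by (intro sum.cong) auto
      then show ?thesis using * True by simp
    qed (use g(2) in auto)
    moreover have "g 0 \<noteq> 0" using g(1)[of 0] that by simp
    ultimately show False using contra by blast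
  qed
  let ?s = "\<tau> + of_nat K + 4 * of_nat j"
  have "Q (\<tau> + of_nat K + of_nat k) \<noteq> 0" if "k > 0" for k
    using roots[of "int (K + k)"] that by (auto simp: add.assoc)
  from generalized_kernel_exists[OF root this] obtain h where
    h: "h 0 \<noteq> 0" "act_pow (euler_symbol Q v) (Suc j) ?s h = (\<lambda>_. 0)" by blast
  let ?g = "act \<mu> ?s h"
  have "act_pow (euler_symbol Q v) (Suc j) (?s - of_nat m) ?g = (\<lambda>_. 0)"
    unfolding act_pow_commute[OF commute] h(2) by simp
  moreover have "?g 0 \<noteq> 0" using nz h(1) unfolding act_def by simp
  moreover have "?s - of_nat m + of_nat 0 = \<tau> + of_int (int K + 4 * int j - int m)" by simp
  ultimately obtain i where "int K + 4 * int j - int m = int K + 4 * int i"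
    using leading_exponent_of_generalized_kernel[OF roots obstructed, of "Suc j" "?s - of_nat m" ?g 0] by blast
  then have "int m = 4 * (int j - int i)" by simp
  then have "int 4 dvd int m" by simp
  then show False using \<open>\<not> 4 dvd m\<close> by (simp only: of_nat_dvd_iff)
qed

section \<open>Commuting operators at a regular singular point\<close>

context commuting_symbols
begin

text \<open>
  The same identities, indexed from the lowest weights -4 and -m of the two operators, in the form
  that no_logarithms expects. The eigenvalue lam changes the coefficient at index 4, where both
  sides contain it with the same factor.
\<close>
lemma regular_commutation:
  fixes lam s :: complex and k :: nat
  assumes reg: "\<And>i. i < -4 \<Longrightarrow> \<phi> i = 0"
  defines "A \<equiv> euler_symbol (\<lambda>s. poly quartic s + \<phi> (-4)) (\<lambda>k. \<phi> (int k - 4) - (if k = 4 then lam else 0))"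
    and "\<mu> \<equiv> \<lambda>k s. poly (\<nu> (int k - int m)) s"
  shows "(\<Sum>i\<le>k. A (k - i) (s - of_nat m + of_nat i) * \<mu> i s)
       = (\<Sum>i\<le>k. \<mu> (k - i) (s - 4 + of_nat i) * A i s)"
proof -
  define w where "w = int k - int m"
  define v where "v = (\<lambda>j::nat. \<phi> (int j - 4) - (if j = 4 then lam else 0))"
  let ?t = "\<lambda>i. \<phi> i * (poly (\<nu> (w - 4 - i)) s - poly (\<nu> (w - 4 - i)) (of_int i + s))"
  have "poly quartic (of_int w + s) * poly (\<nu> w) s - poly quartic s * poly (\<nu> w) (-4 + s)
      + (\<Sum>i = - int B..w - 4 + int D. ?t i) = 0"
    using arg_cong[OF commutation[of w], of "\<lambda>p. poly p s"]
    by (simp add: poly_sum poly_pcompose)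
  also have "(\<Sum>i = - int B..w - 4 + int D. ?t i) = (\<Sum>i\<in>{-4..int k - 4}. ?t i)"
  proof -
    have 0: "?t i = 0" if out: "i < -4 \<or> i > int k - 4 \<or> i < - int B \<or> i > w - 4 + int D" for i
    proof -
      consider "i < -4" | "i > int k - 4" | "i < - int B" | "i > w - 4 + int D" using out by blast
      then show ?thesis
      proof cases
        case 2
        then have "w - 4 - i < - int m" unfolding w_def by simp
        then show ?thesis using lowest_symbol[OF reg] by simp
      next
        case 4
        then have "w - 4 - i < - int D" by simp
        then show ?thesis using nu_low by simp
      qed (use reg phi_low in auto)
    qed
    have "(\<Sum>i = - int B..w - 4 + int D. ?t i) = (\<Sum>i\<in>{- int B..w - 4 + int D} \<inter> {-4..int k - 4}. ?t i)"
    proof (rule sum.mono_neutral_right)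
      show "\<forall>i\<in>{- int B..w - 4 + int D} - {- int B..w - 4 + int D} \<inter> {-4..int k - 4}. ?t i = 0"
      proof
        fix i assume "i \<in> {- int B..w - 4 + int D} - {- int B..w - 4 + int D} \<inter> {-4..int k - 4}"
        then show "?t i = 0" by (intro 0) auto
      qed
    qed auto
    also have "\<dots> = (\<Sum>i\<in>{-4..int k - 4}. ?t i)"
    proof (rule sum.mono_neutral_left)
      show "\<forall>i\<in>{-4..int k - 4} - {- int B..w - 4 + int D} \<inter> {-4..int k - 4}. ?t i = 0"
      proof
        fix i assume "i \<in> {-4..int k - 4} - {- int B..w - 4 + int D} \<inter> {-4..int k - 4}"
        then show "?t i = 0" by (intro 0) auto
      qed
    qed auto
    finally show ?thesis .
  qed
  also have "(\<Sum>i\<in>{-4..int k - 4}. ?t i) = (\<Sum>j\<le>k. ?t (int j - 4))"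
    by (rule sum.reindex_bij_witness[of _ "\<lambda>j. int j - 4" "\<lambda>i. nat (i + 4)"]) auto
  also have "\<dots> = (\<Sum>j\<le>k. v j * (\<mu> (k - j) s - \<mu> (k - j) (s - 4 + of_nat j))) "
  proof (intro sum.cong refl)
    fix j assume "j \<in> {..k}"
    then have 1: "w - 4 - (int j - 4) = int (k - j) - int m" unfolding w_def by simp
    have 2: "of_int (int j - 4) + s = s - 4 + of_nat j" by simp
    have "?t (int j - 4) = \<phi> (int j - 4) * (\<mu> (k - j) s - \<mu> (k - j) (s - 4 + of_nat j))"
      unfolding \<mu>_def 1 2 ..
    also have "\<dots> = v j * (\<mu> (k - j) s - \<mu> (k - j) (s - 4 + of_nat j))"
      unfolding v_def by (cases "j = 4") auto
    finally show "?t (int j - 4) = v j * (\<mu> (k - j) s - \<mu> (k - j) (s - 4 + of_nat j))" .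
  qed
  also have "\<dots> = \<phi> (-4) * (\<mu> k s - \<mu> k (s - 4))
      + (\<Sum>j\<in>{0<..k}. v j * (\<mu> (k - j) s - \<mu> (k - j) (s - 4 + of_nat j)))"
  proof -
    have "{..k} = insert 0 {0<..k}" by auto
    then show ?thesis by (simp add: v_def)
  qed
  finally have main: "poly quartic (of_int w + s) * \<mu> k s - poly quartic s * \<mu> k (s - 4)
     + (\<phi> (-4) * (\<mu> k s - \<mu> k (s - 4))
      + (\<Sum>j\<in>{0<..k}. v j * (\<mu> (k - j) s - \<mu> (k - j) (s - 4 + of_nat j)))) = 0"
    by (simp add: \<mu>_def w_def)
  have A1: "A j t = v j" if "j > 0" for j t
    using that unfolding A_def euler_symbol_def v_def by auto
  have A0: "A 0 t = poly quartic t + \<phi> (-4)" for t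
    unfolding A_def euler_symbol_def by simp
  have "(\<Sum>i\<le>k. A (k - i) (s - of_nat m + of_nat i) * \<mu> i s)
      = (\<Sum>j\<le>k. A j (s - of_nat m + of_nat (k - j)) * \<mu> (k - j) s)"
    by (rule sum.reindex_bij_witness[of _ "\<lambda>j. k - j" "\<lambda>j. k - j"]) auto
  also have "\<dots> = A 0 (s - of_nat m + of_nat k) * \<mu> k s + (\<Sum>j\<in>{0<..k}. v j * \<mu> (k - j) s)"
  proof -
    have "{..k} = insert 0 {0<..k}" by auto
    then show ?thesis by (simp add: A1)
  qed
  finally have l: "(\<Sum>i\<le>k. A (k - i) (s - of_nat m + of_nat i) * \<mu> i s)
      = A 0 (s - of_nat m + of_nat k) * \<mu> k s + (\<Sum>j\<in>{0<..k}. v j * \<mu> (k - j) s)" .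
  have r: "(\<Sum>i\<le>k. \<mu> (k - i) (s - 4 + of_nat i) * A i s)
      = A 0 s * \<mu> k (s - 4) + (\<Sum>j\<in>{0<..k}. v j * \<mu> (k - j) (s - 4 + of_nat j))"
  proof -
    have "{..k} = insert 0 {0<..k}" by auto
    then show ?thesis by (simp add: A1 mult.commute)
  qed
  have w: "of_int w + s = s - of_nat m + of_nat k" by (simp add: w_def)
  show ?thesis
    using main unfolding l r A0 w by (simp add: algebra_simps sum_subtractf)
qed

lemma lowest_symbol_relation:
  assumes reg: "\<And>i. i < -4 \<Longrightarrow> \<phi> i = 0"
  shows "(poly quartic (s - of_nat m) + \<phi> (-4)) * poly (\<nu> (- int m)) s
       = poly (\<nu> (- int m)) (s - 4) * (poly quartic s + \<phi> (-4))"
  using regular_commutation[OF reg, where lam = 0 and k = 0 and s = s]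
  by (simp add: euler_symbol_def)

text \<open>
  By the relation between lowest symbols, a zero of P at \<tau> + 4k - 4 produces one at \<tau> + 4k, as
  long as Q does not vanish at \<tau> + 4k - m; for odd m this is an odd integer away from \<tau>. The chain
  starts because Q vanishes at \<tau>.
\<close>
lemma order_even:
  assumes reg: "\<And>i. i < -4 \<Longrightarrow> \<phi> i = 0"
    and root: "poly quartic \<tau> + \<phi> (-4) = 0"
    and no_odd_root: "\<And>z::int. odd z \<Longrightarrow> poly quartic (\<tau> + of_int z) + \<phi> (-4) \<noteq> 0"
  shows "even m"
proof (rule ccontr)
  assume "odd m"
  let ?P = "\<nu> (- int m)"
  have "poly ?P (\<tau> + 4 * of_nat k) = 0" for k
  proof (induction k)
    case 0
    have "poly quartic (\<tau> - of_nat m) + \<phi> (-4) \<noteq> 0"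
      using no_odd_root[of "- int m"] \<open>odd m\<close> by simp
    then show ?case using lowest_symbol_relation[OF reg, of \<tau>] root by simp
  next
    case (Suc k)
    have "poly quartic (\<tau> + 4 * of_nat (Suc k) - of_nat m) + \<phi> (-4) \<noteq> 0"
      using no_odd_root[of "4 * int (Suc k) - int m"] \<open>odd m\<close> by (simp add: algebra_simps)
    moreover have "\<tau> + 4 * of_nat (Suc k) - 4 = \<tau> + 4 * of_nat k" by simp
    ultimately show ?case
      using lowest_symbol_relation[OF reg, of "\<tau> + 4 * of_nat (Suc k)"] Suc
      by (metis mult_eq_0_iff)
  qed
  then have "range (\<lambda>k::nat. \<tau> + 4 * of_nat k) \<subseteq> {s. poly ?P s = 0}" by auto
  moreover have "infinite (range (\<lambda>k::nat. \<tau> + 4 * of_nat k))"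
    by (rule range_inj_infinite) (auto intro: injI)
  ultimately have "?P = 0" using poly_roots_finite finite_subset by blast
  then show False using leading_coefficient_nonzero by simp
qed

text \<open>
  The upper root is never resonant. At the lower root no_logarithms applies, with an index j for
  which the lowest symbol does not vanish; a nonzero polynomial cannot vanish on a whole
  arithmetic progression.
\<close>
lemma frobenius_solutions_exist:
  fixes lam \<tau> :: complex and K :: nat
  assumes reg: "\<And>i. i < -4 \<Longrightarrow> \<phi> i = 0" and "\<not> 4 dvd m"
    and root: "poly quartic \<tau> + \<phi> (-4) = 0" "poly quartic (\<tau> + of_nat K) + \<phi> (-4) = 0"
    and roots: "\<And>z::int. poly quartic (\<tau> + of_int z) + \<phi> (-4) = 0 \<Longrightarrow> z = 0 \<or> z = int K"
  defines "A \<equiv> euler_symbol (\<lambda>s. poly quartic s + \<phi> (-4)) (\<lambda>k. \<phi> (int k - 4) - (if k = 4 then lam else 0))"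
  shows "\<exists>f. f 0 \<noteq> 0 \<and> (\<forall>k. act A \<tau> f k = 0)" (is ?low)
    and "\<exists>f. f 0 \<noteq> 0 \<and> (\<forall>k. act A (\<tau> + of_nat K) f k = 0)" (is ?high)
proof -
  let ?\<mu> = "\<lambda>k s. poly (\<nu> (int k - int m)) s"
  have "\<exists>j. ?\<mu> 0 (\<tau> + of_nat K + 4 * of_nat j) \<noteq> 0"
  proof (rule ccontr)
    assume "\<not> ?thesis"
    then have "range (\<lambda>j::nat. \<tau> + of_nat K + 4 * of_nat j) \<subseteq> {s. poly (\<nu> (- int m)) s = 0}" by auto
    moreover have "infinite (range (\<lambda>j::nat. \<tau> + of_nat K + 4 * of_nat j))"
      by (rule range_inj_infinite) (auto intro: injI)
    ultimately have "\<nu> (- int m) = 0" using poly_roots_finite finite_subset by blast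
    then show False using leading_coefficient_nonzero by simp
  qed
  then obtain j where "?\<mu> 0 (\<tau> + of_nat K + 4 * of_nat j) \<noteq> 0" by blast
  then show ?low
    unfolding A_def
    by (intro no_logarithms[where \<mu> = ?\<mu> and m = m and j = j and K = K])
       (use root roots regular_commutation[OF reg] \<open>\<not> 4 dvd m\<close> in auto)
  have "poly quartic (\<tau> + of_nat K + of_nat k) + \<phi> (-4) \<noteq> 0" if "k > 0" for k
    using roots[of "int (K + k)"] that by (auto simp: add.assoc)
  from generalized_kernel_exists[of "\<lambda>s. poly quartic s + \<phi> (-4)", OF root(2) this,
      of "\<lambda>k. \<phi> (int k - 4) - (if k = 4 then lam else 0)" 0]
  obtain h where "h 0 \<noteq> 0" "act A (\<tau> + of_nat K) h = (\<lambda>_. 0)" unfolding A_def by auto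
  then show ?high by (intro exI[of _ h]) simp
qed

end

section \<open>Symbols from Laurent expansions\<close>

text \<open>
  The polynomial s(s-1)...(s-j+1), by which d^j acts on x^s.
\<close>
primrec falling :: "nat \<Rightarrow> complex poly" where
  "falling 0 = 1"
| "falling (Suc j) = falling j * [:- of_nat j, 1:]"

lemma falling_nz: "falling j \<noteq> 0"
  by (induction j) (auto simp del: mult_pCons_right)

lemma degree_falling: "degree (falling j) = j"
  by (induction j) (auto simp: degree_mult_eq falling_nz simp del: mult_pCons_right)

lemma lead_coeff_falling: "coeff (falling j) j = 1"
proof (induction j)
  case (Suc j)
  have "coeff (falling (Suc j)) (Suc j) = lead_coeff (falling j * [:- of_nat j, 1:])"
    by (simp only: falling.simps degree_falling[of "Suc j", unfolded falling.simps])
  also have "\<dots> = 1" unfolding lead_coeff_mult using Suc by (simp add: degree_falling)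
  finally show ?case .
qed simp

lemma falling_4: "falling 4 = quartic"
  by (simp add: eval_nat_numeral quartic_def)

lemma fls_deriv_funpow_nth:
  "fls_nth ((fls_deriv ^^ j) g) i = poly (falling j) (of_int (i + int j)) * fls_nth g (i + int j)"
proof (induction j arbitrary: i)
  case (Suc j)
  have "fls_nth ((fls_deriv ^^ Suc j) g) i = of_int (i + 1) * fls_nth ((fls_deriv ^^ j) g) (i + 1)"
    by simp
  also have "\<dots> = poly (falling (Suc j)) (of_int (i + int (Suc j))) * fls_nth g (i + int (Suc j))"
    unfolding Suc by (simp add: algebra_simps)
  finally show ?case .
qed simp

lemma fls_mult_nth_finite:
  fixes f g :: "complex fls"
  assumes "finite I" "\<And>i. i \<notin> I \<Longrightarrow> fls_nth f (n - i) = 0 \<or> fls_nth g i = 0"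
  shows "fls_nth (f * g) n = (\<Sum>i\<in>I. fls_nth f (n - i) * fls_nth g i)"
proof -
  let ?J = "{fls_subdegree g..n - fls_subdegree f}"
  have "fls_nth (f * g) n = (\<Sum>i\<in>?J. fls_nth g i * fls_nth f (n - i))"
    using fls_times_nth(2)[of g f n] by (simp add: mult.commute)
  also have "\<dots> = (\<Sum>i\<in>?J. fls_nth f (n - i) * fls_nth g i)"
    by (simp add: mult.commute)
  also have "\<dots> = (\<Sum>i\<in>?J \<union> I. fls_nth f (n - i) * fls_nth g i)"
  proof (rule sum.mono_neutral_left)
    show "\<forall>i\<in>?J \<union> I - ?J. fls_nth f (n - i) * fls_nth g i = 0"
    proof
      fix i assume "i \<in> ?J \<union> I - ?J"
      then have "i < fls_subdegree g \<or> n - i < fls_subdegree f" by auto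
      then show "fls_nth f (n - i) * fls_nth g i = 0" by auto
    qed
  qed (use assms in auto)
  also have "\<dots> = (\<Sum>i\<in>I. fls_nth f (n - i) * fls_nth g i)"
    by (rule sum.mono_neutral_right) (use assms in auto)
  finally show ?thesis .
qed

definition fls_op :: "complex fls list \<Rightarrow> complex fls \<Rightarrow> complex fls" where
  "fls_op Fs g = (\<Sum>j<length Fs. Fs ! j * (fls_deriv ^^ j) g)"

definition symbol :: "complex fls list \<Rightarrow> int \<Rightarrow> complex poly" where
  "symbol Fs w = (\<Sum>j<length Fs. smult (fls_nth (Fs ! j) (w + int j)) (falling j))"

lemma fls_deriv_funpow_add: "(fls_deriv ^^ j) (g + h) = (fls_deriv ^^ j) g + (fls_deriv ^^ j) (h :: complex fls)"
  by (induction j) auto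

lemma fls_op_add: "fls_op Fs (g + h) = fls_op Fs g + fls_op Fs h"
  unfolding fls_op_def fls_deriv_funpow_add by (simp add: ring_distribs sum.distrib)

lemma fls_op_nth:
  assumes D: "\<And>j i. j < length Fs \<Longrightarrow> i < int j - int D \<Longrightarrow> fls_nth (Fs ! j) i = 0"
    and I: "finite I" "\<And>l. l \<notin> I \<Longrightarrow> l \<le> n + int D \<Longrightarrow> fls_nth g l = 0"
  shows "fls_nth (fls_op Fs g) n = (\<Sum>l\<in>I. poly (symbol Fs (n - l)) (of_int l) * fls_nth g l)"
proof -
  have "fls_nth (Fs ! j * (fls_deriv ^^ j) g) n
      = (\<Sum>l\<in>I. fls_nth (Fs ! j) (n - l + int j) * poly (falling j) (of_int l) * fls_nth g l)"
    if j: "j < length Fs" for j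
  proof -
    have "fls_nth (Fs ! j * (fls_deriv ^^ j) g) n
      = (\<Sum>i\<in>(\<lambda>l. l - int j) ` I. fls_nth (Fs ! j) (n - i) * fls_nth ((fls_deriv ^^ j) g) i)"
    proof (rule fls_mult_nth_finite)
      fix i assume i: "i \<notin> (\<lambda>l. l - int j) ` I"
      then have "i + int j \<notin> I" by force
      then have "i + int j \<le> n + int D \<Longrightarrow> fls_nth g (i + int j) = 0" using I(2) by blast
      moreover have "\<not> i + int j \<le> n + int D \<Longrightarrow> fls_nth (Fs ! j) (n - i) = 0"
        by (rule D[OF j]) linarith
      ultimately show "fls_nth (Fs ! j) (n - i) = 0 \<or> fls_nth ((fls_deriv ^^ j) g) i = 0"
        unfolding fls_deriv_funpow_nth by (metis mult_zero_right)
    qed (use I in auto)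
    also have "\<dots> = (\<Sum>l\<in>I. fls_nth (Fs ! j) (n - (l - int j)) * fls_nth ((fls_deriv ^^ j) g) (l - int j))"
      by (subst sum.reindex) (auto intro: inj_onI)
    also have "\<dots> = (\<Sum>l\<in>I. fls_nth (Fs ! j) (n - l + int j) * poly (falling j) (of_int l) * fls_nth g l)"
      unfolding fls_deriv_funpow_nth by (intro sum.cong) (auto simp: algebra_simps)
    finally show ?thesis .
  qed
  then have "fls_nth (fls_op Fs g) n = (\<Sum>j<length Fs. \<Sum>l\<in>I. fls_nth (Fs ! j) (n - l + int j) *
      poly (falling j) (of_int l) * fls_nth g l)"
    unfolding fls_op_def fls_nth_sum by (intro sum.cong) auto
  also have "\<dots> = (\<Sum>l\<in>I. poly (symbol Fs (n - l)) (of_int l) * fls_nth g l)"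
    by (subst sum.swap) (simp add: symbol_def poly_sum sum_distrib_right)
  finally show ?thesis .
qed

text \<open>
  Both products of operators are applied to x^k for natural numbers k. Each coefficient of the
  difference is the value at k of one fixed polynomial, which has infinitely many zeros.
\<close>
lemma symbol_commutation:
  fixes F :: "complex fls"
  assumes D: "\<And>j i. j < length Fs \<Longrightarrow> i < int j - int D \<Longrightarrow> fls_nth (Fs ! j) i = 0"
    and B: "\<And>i. i < - int B \<Longrightarrow> fls_nth F i = 0"
    and comm: "\<And>k. fls_op [F, 0, 0, 0, 1] (fls_op Fs (fls_X ^ k)) = fls_op Fs (fls_op [F, 0, 0, 0, 1] (fls_X ^ k))"
  defines "\<nu> \<equiv> symbol Fs"
  shows "pcompose quartic [:of_int w, 1:] * \<nu> w - quartic * pcompose (\<nu> w) [:-4, 1:]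
      + (\<Sum>i = - int B..w - 4 + int D.
          smult (fls_nth F i) (\<nu> (w - 4 - i) - pcompose (\<nu> (w - 4 - i)) [:of_int i, 1:])) = 0"
    (is "?p = 0")
proof -
  have L: "fls_op [F, 0, 0, 0, 1] g = F * g + (fls_deriv ^^ 4) g" for g
    by (simp add: fls_op_def numeral_eq_Suc lessThan_Suc)
  have X: "fls_nth (fls_X ^ k) l = (if l = int k then 1 else 0 :: complex)" for k l
    by (simp add: fls_X_power_nth)
  have low: "\<nu> v = 0" if "v < - int D" for v
    unfolding \<nu>_def symbol_def using D that by (intro sum.neutral) auto
  have NX: "fls_nth (fls_op Fs (fls_X ^ k)) l = poly (\<nu> (l - int k)) (of_nat k)" for k l
    using fls_op_nth[where I = "{int k}" and n = l and g = "fls_X ^ k", OF D] unfolding X \<nu>_def by auto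
  have zero: "poly ?p (of_nat k) = 0" for k :: nat
  proof -
    let ?n = "int k + w - 4" and ?I = "{- int B..w - 4 + int D}"
    have 1: "fls_nth ((fls_deriv ^^ 4) (fls_op Fs (fls_X ^ k))) ?n
        = poly quartic (of_nat k + of_int w) * poly (\<nu> w) (of_nat k)"
      unfolding fls_deriv_funpow_nth NX falling_4 by simp
    have "fls_nth (F * fls_op Fs (fls_X ^ k)) ?n = fls_nth (fls_op Fs (fls_X ^ k) * F) ?n"
      by (simp add: mult.commute)
    also have "\<dots> = (\<Sum>i\<in>?I. fls_nth (fls_op Fs (fls_X ^ k)) (?n - i) * fls_nth F i)"
    proof (rule fls_mult_nth_finite)
      fix i assume "i \<notin> ?I"
      then have "i < - int B \<or> w - 4 - i < - int D" by auto
      then have "fls_nth F i = 0 \<or> \<nu> (?n - i - int k) = 0" using B low by (auto simp: algebra_simps)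
      then show "fls_nth (fls_op Fs (fls_X ^ k)) (?n - i) = 0 \<or> fls_nth F i = 0"
        unfolding NX by auto
    qed simp
    also have "\<dots> = (\<Sum>i\<in>?I. fls_nth F i * poly (\<nu> (w - 4 - i)) (of_nat k))"
      unfolding NX by (intro sum.cong) (auto simp: algebra_simps)
    finally have 2: "fls_nth (F * fls_op Fs (fls_X ^ k)) ?n
      = (\<Sum>i\<in>?I. fls_nth F i * poly (\<nu> (w - 4 - i)) (of_nat k))" .
    have FX: "fls_nth (F * fls_X ^ k) l = fls_nth F (l - int k)" for l
      using fls_mult_nth_finite[of "{int k}" F l "fls_X ^ k"] unfolding X by auto
    have "fls_nth (fls_op Fs (F * fls_X ^ k)) ?n
       = (\<Sum>l\<in>(\<lambda>i. int k + i) ` ?I. poly (symbol Fs (?n - l)) (of_int l) * fls_nth (F * fls_X ^ k) l)"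
    proof (rule fls_op_nth[OF D])
      fix l assume "l \<notin> (\<lambda>i. int k + i) ` ?I" "l \<le> ?n + int D"
      moreover from this have "l - int k \<notin> ?I" by force
      ultimately have "l - int k < - int B" by auto
      then show "fls_nth (F * fls_X ^ k) l = 0" unfolding FX by (rule B)
    qed auto
    also have "\<dots> = (\<Sum>i\<in>?I. fls_nth F i * poly (\<nu> (w - 4 - i)) (of_int i + of_nat k))"
      unfolding FX \<nu>_def by (subst sum.reindex) (auto simp: algebra_simps intro!: inj_onI sum.cong)
    finally have 3: "fls_nth (fls_op Fs (F * fls_X ^ k)) ?n
      = (\<Sum>i\<in>?I. fls_nth F i * poly (\<nu> (w - 4 - i)) (of_int i + of_nat k))" .
    have "fls_nth (fls_op Fs ((fls_deriv ^^ 4) (fls_X ^ k))) ?n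
       = (\<Sum>l\<in>{int k - 4}. poly (symbol Fs (?n - l)) (of_int l) * fls_nth ((fls_deriv ^^ 4) (fls_X ^ k)) l)"
      by (rule fls_op_nth[OF D]) (auto simp: fls_deriv_funpow_nth X)
    also have "\<dots> = poly quartic (of_nat k) * poly (\<nu> w) (-4 + of_nat k)"
      unfolding fls_deriv_funpow_nth X falling_4 \<nu>_def by (simp add: algebra_simps)
    finally have 4: "fls_nth (fls_op Fs ((fls_deriv ^^ 4) (fls_X ^ k))) ?n
      = poly quartic (of_nat k) * poly (\<nu> w) (-4 + of_nat k)" .
    have "(\<Sum>i\<in>?I. fls_nth F i * poly (\<nu> (w - 4 - i)) (of_nat k))
        + poly quartic (of_nat k + of_int w) * poly (\<nu> w) (of_nat k)
      = (\<Sum>i\<in>?I. fls_nth F i * poly (\<nu> (w - 4 - i)) (of_int i + of_nat k))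
        + poly quartic (of_nat k) * poly (\<nu> w) (-4 + of_nat k)"
      using arg_cong[OF comm[of k], of "\<lambda>f. fls_nth f ?n"]
      unfolding L fls_op_add fls_plus_nth 1 2 3 4 .
    then show ?thesis
      by (simp add: poly_sum poly_pcompose sum_subtractf algebra_simps)
  qed
  show ?thesis
  proof (rule ccontr)
    assume "?p \<noteq> 0"
    then have "finite {x. poly ?p x = 0}" by (rule poly_roots_finite)
    then have "finite (range (of_nat :: nat \<Rightarrow> complex))"
      by (rule finite_subset[rotated]) (use zero in blast)
    then show False using infinite_UNIV_char_0 finite_imageD inj_of_nat
      by (metis infinite_UNIV_nat)
  qed
qed

lemma has_laurent_expansion_funpow_deriv:
  assumes "(\<lambda>x. f (a + x)) has_laurent_expansion G"
  shows "(\<lambda>x. (deriv ^^ j) f (a + x)) has_laurent_expansion (fls_deriv ^^ j) G"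
proof (induction j)
  case (Suc j)
  have "deriv (\<lambda>x. h (a + x)) = (\<lambda>x. deriv h (a + x))" for h :: "complex \<Rightarrow> complex"
    unfolding deriv_def using DERIV_shift[of h _ _ a] by (auto simp: add.commute fun_eq_iff)
  then show ?case
    using has_laurent_expansion_deriv[OF Suc] by simp
qed (use assms in simp)

lemma has_laurent_expansion_apply_op:
  assumes "\<And>c. c \<in> set P \<Longrightarrow> c meromorphic_on UNIV"
    and "(\<lambda>x. f (a + x)) has_laurent_expansion G"
  shows "(\<lambda>x. apply_op P f (a + x)) has_laurent_expansion fls_op (map (\<lambda>c. laurent_expansion c a) P) G"
proof -
  have "(\<lambda>x. \<Sum>j<length P. (P ! j) (a + x) * (deriv ^^ j) f (a + x)) has_laurent_expansion
     (\<Sum>j<length P. laurent_expansion (P ! j) a * (fls_deriv ^^ j) G)"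
    using assms by (intro laurent_expansion_intros has_laurent_expansion_funpow_deriv
        meromorphic_on_imp_has_laurent_expansion[of _ UNIV]) auto
  then show ?thesis
    unfolding apply_op_def fls_op_def by simp
qed

text \<open>
  The plane is connected, so a meromorphic function that does not vanish almost everywhere has only
  a sparse set of zeros, and a is an isolated point of the zeros and singularities.
\<close>
lemma ordinary_punctured_ball:
  assumes "\<And>c. c \<in> set P \<Longrightarrow> c meromorphic_on UNIV" "P \<noteq> []"
    and "\<not> eventually (\<lambda>z. last P z = 0) (cosparse UNIV)"
  shows "\<exists>r>0. \<forall>s. s \<le> r \<longrightarrow> ordinary_on P (ball a s - {a})"
proof -
  have "eventually (\<lambda>z. \<forall>c\<in>set P. c analytic_on {z}) (at a)"
    using assms(1) meromorphic_on_imp_analytic_cosparse[of _ UNIV]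
    by (intro eventually_ball_finite ballI finite_set)
       (blast intro: eventually_cosparse_imp_eventually_at)
  moreover have "last P meromorphic_on UNIV" using assms(1,2) by simp
  from meromorphic_imp_constant_or_avoid[OF this, of 0] assms(3)
  have "eventually (\<lambda>z. last P z \<noteq> 0) (cosparse UNIV)" by auto
  then have "eventually (\<lambda>z. last P z \<noteq> 0) (at a)"
    by (blast intro: eventually_cosparse_imp_eventually_at)
  ultimately have "eventually (\<lambda>z. (\<forall>c\<in>set P. c analytic_on {z}) \<and> last P z \<noteq> 0) (at a)"
    by (rule eventually_conj)
  then obtain r where r: "r > 0" "\<And>z. z \<noteq> a \<Longrightarrow> dist z a < r \<Longrightarrow> (\<forall>c\<in>set P. c analytic_on {z}) \<and> last P z \<noteq> 0"
    unfolding eventually_at by auto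
  have "ordinary_on P (ball a s - {a})" if "s \<le> r" for s
    unfolding ordinary_on_def
    using r(2) that by (subst analytic_on_analytic_at) (auto simp: dist_commute)
  then show ?thesis using r(1) by blast
qed

text \<open>
  On a punctured disc about a both operators have only ordinary points, so there they commute on
  the polynomials (z - a)^k. Taking Laurent expansions turns this into an identity of formal
  series.
\<close>
theorem commuting_symbols_of_commuting_operators:
  fixes a :: complex
  assumes u: "u meromorphic_on UNIV" and N: "diffop_of_order m N" and comm: "ops_commute (L4 u) N"
  defines "Fs \<equiv> map (\<lambda>c. laurent_expansion c a) N"
  shows "\<exists>B D. commuting_symbols (fls_nth (laurent_expansion u a)) (symbol Fs) m B D"
proof -
  let ?F = "laurent_expansion u a"
  have len: "length N = Suc m" and mero: "\<And>c. c \<in> set N \<Longrightarrow> c meromorphic_on UNIV"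
    and last: "\<not> eventually (\<lambda>z. last N z = 0) (cosparse UNIV)"
    using N last_conv_nth[of N] unfolding diffop_of_order_def by force+
  have len': "length Fs = Suc m" unfolding Fs_def using len by simp
  define B where "B = nat (- fls_subdegree ?F)"
  define D where "D = Max ((\<lambda>j. nat (int j - fls_subdegree (Fs ! j))) ` {..m})"
  have low: "fls_nth (Fs ! j) i = 0" if "j < length Fs" "i < int j - int D" for j i
  proof -
    have "nat (int j - fls_subdegree (Fs ! j)) \<le> D"
      unfolding D_def using that len' by (intro Max_ge) auto
    then show ?thesis using that by (intro fls_eq0_below_subdegree) linarith
  qed
  have meroL: "c meromorphic_on UNIV" if "c \<in> set (L4 u)" for c
    using that u by (auto simp: L4_def intro: meromorphic_intros)
  have L4_map: "map (\<lambda>c. laurent_expansion c a) (L4 u) = [?F, 0, 0, 0, 1]"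
    unfolding L4_def by (auto intro!: laurent_expansion_eqI)
  have "\<not> eventually (\<lambda>z. last (L4 u) z = 0) (cosparse UNIV)"
    by (simp add: L4_def)
  from ordinary_punctured_ball[OF meroL _ this, of a] obtain r1 where
    r1: "r1 > 0" "\<And>s. s \<le> r1 \<Longrightarrow> ordinary_on (L4 u) (ball a s - {a})" by (auto simp: L4_def)
  from ordinary_punctured_ball[OF mero _ last, of a] len obtain r2 where
    r2: "r2 > 0" "\<And>s. s \<le> r2 \<Longrightarrow> ordinary_on N (ball a s - {a})" by force
  define r where "r = min r1 r2"
  have r: "r > 0" "ordinary_on (L4 u) (ball a r - {a})" "ordinary_on N (ball a r - {a})"
    using r1 r2 unfolding r_def by auto
  have comm_fls: "fls_op [?F, 0, 0, 0, 1] (fls_op Fs (fls_X ^ k)) = fls_op Fs (fls_op [?F, 0, 0, 0, 1] (fls_X ^ k))" for k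
  proof -
    let ?f = "\<lambda>z. (z - a) ^ k"
    have f: "(\<lambda>x. ?f (a + x)) has_laurent_expansion fls_X ^ k"
      by (auto intro!: laurent_expansion_intros)
    have 1: "(\<lambda>x. apply_op (L4 u) (apply_op N ?f) (a + x)) has_laurent_expansion
        fls_op [?F, 0, 0, 0, 1] (fls_op Fs (fls_X ^ k))"
      unfolding L4_map[symmetric] Fs_def
      by (intro has_laurent_expansion_apply_op f mero meroL)
    have 2: "(\<lambda>x. apply_op N (apply_op (L4 u) ?f) (a + x)) has_laurent_expansion
        fls_op Fs (fls_op [?F, 0, 0, 0, 1] (fls_X ^ k))"
      unfolding L4_map[symmetric] Fs_def
      by (intro has_laurent_expansion_apply_op f mero meroL)
    have eq: "apply_op (L4 u) (apply_op N ?f) z = apply_op N (apply_op (L4 u) ?f) z"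
      if "z \<in> ball a r - {a}" for z
    proof -
      have "?f holomorphic_on ball a r - {a}" by (intro holomorphic_intros)
      then show ?thesis using comm r(2,3) that unfolding ops_commute_def by blast
    qed
    have "eventually (\<lambda>x. apply_op (L4 u) (apply_op N ?f) (a + x) = apply_op N (apply_op (L4 u) ?f) (a + x)) (at 0)"
      unfolding eventually_at using r(1) by (intro exI[of _ r]) (auto intro!: eq simp: dist_norm)
    from has_laurent_expansion_cong[OF this refl] 1
    show ?thesis using 2 has_laurent_expansion_unique by blast
  qed
  have phi_low: "fls_nth ?F i = 0" if "i < - int B" for i
    using that unfolding B_def by (intro fls_eq0_below_subdegree) linarith
  have "commuting_symbols (fls_nth ?F) (symbol Fs) m B D"
  proof
    show "fls_nth ?F i = 0" if "i < - int B" for i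
      using that by (rule phi_low)
    show "symbol Fs w = 0" if "w < - int D" for w
      unfolding symbol_def using low that by (intro sum.neutral) auto
    show "degree (symbol Fs w) \<le> m" for w
      unfolding symbol_def using len' degree_falling
      by (intro degree_sum_le) (auto intro: order_trans[OF degree_smult_le])
    have top: "coeff (symbol Fs w) m = fls_nth (Fs ! m) (w + int m)" for w
    proof -
      have "coeff (symbol Fs w) m = (\<Sum>j\<in>{..m}. fls_nth (Fs ! j) (w + int j) * coeff (falling j) m)"
        unfolding symbol_def coeff_sum len' lessThan_Suc_atMost by simp
      also have "\<dots> = (\<Sum>j\<in>{m}. fls_nth (Fs ! j) (w + int j) * coeff (falling j) m)"
        by (intro sum.mono_neutral_right) (auto intro!: coeff_eq_0 simp: degree_falling)
      finally show ?thesis by (simp add: lead_coeff_falling)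
    qed
    have "Fs ! m \<noteq> 0"
    proof
      assume "Fs ! m = 0"
      moreover have "(\<lambda>x. (N ! m) (a + x)) has_laurent_expansion Fs ! m"
        unfolding Fs_def using len mero by (auto intro!: meromorphic_on_imp_has_laurent_expansion[of _ UNIV])
      ultimately have ev: "eventually (\<lambda>x. (N ! m) (a + x) = 0) (at 0)"
        by (simp add: has_laurent_expansion_def)
      have "eventually (\<lambda>z. (N ! m) z = 0) (at a)"
        using ev by (simp add: at_to_0'[of a] eventually_filtermap add.commute)
      moreover have "eventually (\<lambda>z. last N z \<noteq> 0) (at a)"
        unfolding eventually_at using r(1,3) by (intro exI[of _ r]) (auto simp: ordinary_on_def dist_commute)
      ultimately have "eventually (\<lambda>z. False) (at a)"
        by eventually_elim (use len in \<open>simp add: last_conv_nth flip: length_0_conv\<close>)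
      then show False by simp
    qed
    then obtain i where "fls_nth (Fs ! m) i \<noteq> 0" by (metis fls_nonzero_nth)
    then show "\<exists>w. coeff (symbol Fs w) m \<noteq> 0"
      unfolding top by (intro exI[of _ "i - int m"]) simp
    show "pcompose quartic [:of_int w, 1:] * symbol Fs w - quartic * pcompose (symbol Fs w) [:-4, 1:]
      + (\<Sum>i = - int B..w - 4 + int D. smult (fls_nth ?F i)
          (symbol Fs (w - 4 - i) - pcompose (symbol Fs (w - 4 - i)) [:of_int i, 1:])) = 0" for w
      using symbol_commutation[where Fs = Fs and D = D and B = B and F = ?F and w = w] low phi_low comm_fls
      by blast
  qed
  then show ?thesis by blast
qed

section \<open>The solution space on a connected domain\<close>

lemma apply_op_L4: "apply_op (L4 u) f z = u z * f z + (deriv ^^ 4) f z"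
  by (simp add: apply_op_def L4_def numeral_eq_Suc lessThan_Suc)

lemma eigenfunctions_L4_iff:
  "f \<in> eigenfunctions (L4 u) lam U \<longleftrightarrow>
     f holomorphic_on U \<and> (\<forall>z\<in>U. (deriv ^^ 4) f z = (lam - u z) * f z)"
  unfolding eigenfunctions_def apply_op_L4 by (auto simp: algebra_simps)

lemma eigenfunctions_subset:
  assumes "f \<in> eigenfunctions P lam U" "V \<subseteq> U"
  shows "f \<in> eigenfunctions P lam V"
  using assms unfolding eigenfunctions_def by (auto intro: holomorphic_on_subset)

lemma higher_deriv_lincomb:
  assumes "open U" "finite I" "\<And>i. i \<in> I \<Longrightarrow> \<psi> i holomorphic_on U" "z \<in> U"
  shows "(deriv ^^ j) (\<lambda>x. \<Sum>i\<in>I. c i * \<psi> i x) z = (\<Sum>i\<in>I. c i * (deriv ^^ j) (\<psi> i) z)"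
  using assms(2,3)
proof (induction I rule: finite_induct)
  case empty
  then show ?case by simp
next
  case (insert k I)
  have "(deriv ^^ j) (\<lambda>x. c k * \<psi> k x + (\<Sum>i\<in>I. c i * \<psi> i x)) z
      = (deriv ^^ j) (\<lambda>x. c k * \<psi> k x) z + (deriv ^^ j) (\<lambda>x. \<Sum>i\<in>I. c i * \<psi> i x) z"
    by (rule higher_deriv_add[OF _ _ \<open>open U\<close> \<open>z \<in> U\<close>])
       (intro holomorphic_intros insert.prems; simp)+
  also have "(deriv ^^ j) (\<lambda>x. c k * \<psi> k x) z = c k * (deriv ^^ j) (\<psi> k) z"
    by (rule higher_deriv_cmult[OF _ \<open>z \<in> U\<close> \<open>open U\<close>]) (use insert.prems in simp)
  finally show ?case using insert by simp
qed

lemma eigenfunctions_lincomb: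
  assumes "open U" "finite I" "\<And>i. i \<in> I \<Longrightarrow> \<psi> i \<in> eigenfunctions (L4 u) lam U"
  shows "(\<lambda>x. \<Sum>i\<in>I. c i * \<psi> i x) \<in> eigenfunctions (L4 u) lam U"
proof -
  have h: "\<psi> i holomorphic_on U" if "i \<in> I" for i
    using assms(3)[OF that] by (simp add: eigenfunctions_def)
  have "(deriv ^^ 4) (\<lambda>x. \<Sum>i\<in>I. c i * \<psi> i x) z = (lam - u z) * (\<Sum>i\<in>I. c i * \<psi> i z)"
    if "z \<in> U" for z
  proof -
    have "(deriv ^^ 4) (\<lambda>x. \<Sum>i\<in>I. c i * \<psi> i x) z = (\<Sum>i\<in>I. c i * (deriv ^^ 4) (\<psi> i) z)"
      by (rule higher_deriv_lincomb[OF assms(1,2) h that])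
    also have "\<dots> = (\<Sum>i\<in>I. (lam - u z) * (c i * \<psi> i z))"
      using assms(3) that by (intro sum.cong) (auto simp: eigenfunctions_L4_iff)
    finally show ?thesis by (simp only: sum_distrib_left)
  qed
  moreover have "(\<lambda>x. \<Sum>i\<in>I. c i * \<psi> i x) holomorphic_on U"
    by (intro holomorphic_intros h)
  ultimately show ?thesis unfolding eigenfunctions_L4_iff by blast
qed

text \<open>
  The equation expresses all higher derivatives at a point by lower ones, so the
  solution vanishes to infinite order there.
\<close>
lemma eigenfunction_eq_0:
  assumes "open U" "connected U" "u analytic_on U" "f \<in> eigenfunctions (L4 u) lam U"
    and x0: "x0 \<in> U" "\<And>j. j < 4 \<Longrightarrow> (deriv ^^ j) f x0 = 0" and "z \<in> U"
  shows "f z = 0"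
proof -
  have f: "f holomorphic_on U" "\<And>z. z \<in> U \<Longrightarrow> (deriv ^^ 4) f z = (lam - u z) * f z"
    using assms(4) unfolding eigenfunctions_L4_iff by auto
  have u: "u holomorphic_on U" using assms(3) by (rule analytic_imp_holomorphic)
  have "(deriv ^^ n) f x0 = 0" for n
  proof (induction n rule: less_induct)
    case (less n)
    show ?case
    proof (cases "n < 4")
      case True
      then show ?thesis by (rule x0(2))
    next
      case False
      then have n: "n = (n - 4) + 4" by simp
      have "(deriv ^^ n) f x0 = (deriv ^^ (n - 4)) ((deriv ^^ 4) f) x0"
        by (subst n) (simp only: funpow_add o_apply)
      also have "\<dots> = (deriv ^^ (n - 4)) (\<lambda>z. (lam - u z) * f z) x0"
        by (rule higher_deriv_transform_within_open[OF _ _ assms(1) x0(1)])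
           (use f u assms(1) in \<open>auto intro!: holomorphic_intros\<close>)
      also have "\<dots> = (\<Sum>i = 0..n - 4. of_nat ((n - 4) choose i) * (deriv ^^ i) (\<lambda>z. lam - u z) x0
           * (deriv ^^ (n - 4 - i)) f x0)"
        by (rule higher_deriv_mult[OF _ f(1) assms(1) x0(1)]) (intro holomorphic_intros u)
      also have "\<dots> = 0"
        using less False by (intro sum.neutral) auto
      finally show ?thesis .
    qed
  qed
  from holomorphic_fun_eq_0_on_connected[OF f(1) assms(1,2) this x0(1) \<open>z \<in> U\<close>] show ?thesis .
qed

text \<open>
  Gaussian elimination with the pivot p.
\<close>
lemma homogeneous_system_nontrivial_solution:
  fixes A :: "nat \<Rightarrow> nat \<Rightarrow> complex"
  assumes "finite I" "card I > n"
  shows "\<exists>c. (\<exists>i\<in>I. c i \<noteq> 0) \<and> (\<forall>j<n. (\<Sum>i\<in>I. c i * A j i) = 0)"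
  using assms
proof (induction n arbitrary: I A)
  case 0
  then have "I \<noteq> {}" by auto
  then show ?case by (intro exI[of _ "\<lambda>_. 1"]) auto
next
  case (Suc n)
  show ?case
  proof (cases "\<forall>i\<in>I. A n i = 0")
    case True
    from Suc.IH[of I A] Suc.prems obtain c where
      c: "\<exists>i\<in>I. c i \<noteq> 0" "\<forall>j<n. (\<Sum>i\<in>I. c i * A j i) = 0" by auto
    then have "\<forall>j<Suc n. (\<Sum>i\<in>I. c i * A j i) = 0"
      using True by (auto simp: less_Suc_eq)
    then show ?thesis using c(1) by blast
  next
    case False
    then obtain p where p: "p \<in> I" "A n p \<noteq> 0" by blast
    define B where "B = (\<lambda>j i. A j i - A j p * A n i / A n p)"
    have "card (I - {p}) > n" using Suc.prems p(1) by simp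
    from Suc.IH[OF _ this, of B] Suc.prems obtain c where
      c: "\<exists>i\<in>I - {p}. c i \<noteq> 0" "\<And>j. j < n \<Longrightarrow> (\<Sum>i\<in>I - {p}. c i * B j i) = 0" by auto
    define t where "t = - (\<Sum>i\<in>I - {p}. c i * A n i) / A n p"
    have expand: "(\<Sum>i\<in>I. (c(p := t)) i * A j i) = t * A j p + (\<Sum>i\<in>I - {p}. c i * A j i)" for j
      by (subst sum.remove[OF Suc.prems(1) p(1)]) (auto intro!: sum.cong)
    have n: "(\<Sum>i\<in>I. (c(p := t)) i * A n i) = 0"
      using p(2) by (subst expand) (simp add: t_def)
    have "(\<Sum>i\<in>I. (c(p := t)) i * A j i) = 0" if "j < n" for j
    proof -
      have "(\<Sum>i\<in>I - {p}. c i * B j i)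
          = (\<Sum>i\<in>I - {p}. c i * A j i) - (\<Sum>i\<in>I - {p}. c i * A n i) * (A j p / A n p)"
        unfolding B_def sum_distrib_right sum_subtractf[symmetric]
        by (intro sum.cong) (auto simp: field_simps)
      then show ?thesis using c(2)[OF that] by (subst expand) (simp add: t_def)
    qed
    with n have "\<forall>j<Suc n. (\<Sum>i\<in>I. (c(p := t)) i * A j i) = 0" by (auto simp: less_Suc_eq)
    moreover have "\<exists>i\<in>I. (c(p := t)) i \<noteq> 0" using c(1) by auto
    ultimately show ?thesis by blast
  qed
qed

text \<open>
  Five solutions have five jets of length four at a point, which are dependent; by uniqueness the
  same relation holds between the solutions.
\<close>
lemma independent_eigenfunctions_basis:
  assumes U: "open U" "connected U" "U \<noteq> {}" "u analytic_on U"
    and \<psi>: "\<And>i. i \<in> {1..4} \<Longrightarrow> \<psi> i \<in> eigenfunctions (L4 u) lam U"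
    and ind: "\<And>c. (\<forall>z\<in>U. (\<Sum>i\<in>{1..4}. c i * \<psi> i z) = 0) \<Longrightarrow> \<forall>i\<in>{1..4}. c i = 0"
  shows "basis_on U (eigenfunctions (L4 u) lam U) {1..4::nat} \<psi>"
  unfolding basis_on_def
proof (intro conjI ballI allI impI)
  fix f assume f: "f \<in> eigenfunctions (L4 u) lam U"
  define \<psi>' where "\<psi>' = (\<lambda>i. if i = 0 then f else \<psi> i)"
  have \<psi>': "\<psi>' i \<in> eigenfunctions (L4 u) lam U" if "i \<in> {0..4}" for i
    using that f \<psi> unfolding \<psi>'_def by auto
  obtain x0 where x0: "x0 \<in> U" using U by blast
  obtain c where c: "\<exists>i\<in>{0..4}. c i \<noteq> 0"
      "\<And>j. j < 4 \<Longrightarrow> (\<Sum>i\<in>{0..4}. c i * (deriv ^^ j) (\<psi>' i) x0) = 0"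
    using homogeneous_system_nontrivial_solution[of "{0..4}" 4 "\<lambda>j i. (deriv ^^ j) (\<psi>' i) x0"] by auto
  have "(\<Sum>i\<in>{0..4}. c i * \<psi>' i z) = 0" if "z \<in> U" for z
  proof (rule eigenfunction_eq_0[OF U(1,2,4) _ x0 _ that])
    show "(\<lambda>x. \<Sum>i\<in>{0..4}. c i * \<psi>' i x) \<in> eigenfunctions (L4 u) lam U"
      by (rule eigenfunctions_lincomb[OF U(1)]) (use \<psi>' in auto)
    show "(deriv ^^ j) (\<lambda>x. \<Sum>i\<in>{0..4}. c i * \<psi>' i x) x0 = 0" if "j < 4" for j
      using higher_deriv_lincomb[OF U(1) _ _ x0, of "{0..4}" \<psi>' j c] \<psi>' c(2)[OF that]
      by (simp add: eigenfunctions_def)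
  qed
  moreover have "{0..4} = insert 0 {1..4::nat}" by auto
  moreover have "(\<Sum>i\<in>{1..4}. c i * \<psi>' i z) = (\<Sum>i\<in>{1..4}. c i * \<psi> i z)" for z
    by (intro sum.cong) (auto simp: \<psi>'_def)
  ultimately have rel: "c 0 * f z + (\<Sum>i\<in>{1..4}. c i * \<psi> i z) = 0" if "z \<in> U" for z
    using that by (simp add: \<psi>'_def)
  have "c 0 \<noteq> 0"
  proof
    assume "c 0 = 0"
    then have "\<forall>i\<in>{1..4}. c i = 0" using rel by (intro ind) simp
    then have "\<forall>i\<in>{0..4}. c i = 0" using \<open>c 0 = 0\<close> by (metis One_nat_def Suc_leI atLeastAtMost_iff neq0_conv)
    then show False using c(1) by blast
  qed
  have "f z = (\<Sum>i\<in>{1..4}. (- c i / c 0) * \<psi> i z)" if "z \<in> U" for z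
  proof -
    have "(\<Sum>i\<in>{1..4}. (- c i / c 0) * \<psi> i z) = - (\<Sum>i\<in>{1..4}. c i * \<psi> i z) / c 0"
      unfolding sum_negf[symmetric] sum_divide_distrib by (intro sum.cong) auto
    also have "(\<Sum>i\<in>{1..4}. c i * \<psi> i z) = - (c 0 * f z)"
      using rel[OF that] by (simp add: eq_neg_iff_add_eq_0 add.commute)
    finally show ?thesis using \<open>c 0 \<noteq> 0\<close> by simp
  qed
  then show "\<exists>c. \<forall>z\<in>U. f z = (\<Sum>i\<in>{1..4}. c i * \<psi> i z)"
    by (intro exI[of _ "\<lambda>i. - c i / c 0"] ballI)
qed (use \<psi> ind in auto)

section \<open>Convergence of Frobenius series\<close>

lemma quartic_growth:
  "\<exists>N::nat. \<forall>k>N. K * real k < norm (poly quartic (s + of_nat k) + c)"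
proof -
  define K' where "K' = max K 0 + 1"
  have K': "K' > 0" "K' > K" by (auto simp: K'_def)
  obtain r where r: "\<And>z. r \<le> norm z \<Longrightarrow> K' \<le> norm (poly [:-6, 11, -6, 1:] z :: complex)"
    using poly_infinity[of "[:11, -6, 1:]" K' "-6"] by (auto simp: simp del: poly_pCons)
  define N where "N = nat \<lceil>max (norm s + \<bar>r\<bar>) ((K' * norm s + norm c) / (K' - K))\<rceil>"
  have "K * real k < norm (poly quartic (s + of_nat k) + c)" if "k > N" for k
  proof -
    have k: "real k > norm s + \<bar>r\<bar>" "real k > (K' * norm s + norm c) / (K' - K)"
      using that unfolding N_def by linarith+
    have n: "norm (s + of_nat k) \<ge> real k - norm s"
      using norm_triangle_ineq4[of "s + of_nat k" s] by (simp add: norm_of_nat)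
    then have "r \<le> norm (s + of_nat k)" using k(1) by linarith
    then have "K' \<le> norm (poly [:-6, 11, -6, 1:] (s + of_nat k))" by (rule r)
    moreover have "poly quartic z = z * poly [:-6, 11, -6, 1:] z" for z
      by (simp add: quartic_def)
    ultimately have "norm (poly quartic (s + of_nat k)) \<ge> (real k - norm s) * K'"
      using n k(1) K' unfolding norm_mult by (auto intro!: mult_mono simp: norm_mult)
    moreover have "norm (poly quartic (s + of_nat k) + c) \<ge> norm (poly quartic (s + of_nat k)) - norm c"
      by (metis norm_diff_ineq)
    moreover have "K' * norm s + norm c < real k * (K' - K)"
      using k(2) K' by (simp add: pos_divide_less_eq)
    ultimately show ?thesis by (simp add: algebra_simps)
  qed
  then show ?thesis by blast
qed

text \<open>
  For r below the radius of convergence of v, the numbers |v k| r^k are bounded by some K. The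
  recursion bounds |Q(s + k)| |f k| r^k by K k times the maximum of the earlier
  |f i| r^i, and |Q(s + k)| > K k for large k; so |f k| r^k stays bounded.
\<close>
lemma frobenius_series_converges:
  fixes v f :: "complex fps"
  assumes sol: "\<And>k. act (euler_symbol (\<lambda>s. poly quartic s + c) (fps_nth v)) s (fps_nth f) k = 0"
  shows "fps_conv_radius v \<le> fps_conv_radius f"
  unfolding fps_conv_radius_def
proof (rule conv_radius_geI_ex')
  fix r0 assume r0: "0 < r0" "ereal r0 < conv_radius (fps_nth v)"
  obtain r where r: "r0 < r" "ereal r < conv_radius (fps_nth v)"
    using ereal_dense2[OF r0(2)] by (metis ereal_dense2 ereal_less_eq(3) less_ereal.simps(1) r0(2))
  have rpos: "r > 0" using r r0 by simp
  have "summable (\<lambda>n. fps_nth v n * of_real r ^ n)"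
    using r(2) rpos by (intro summable_in_conv_radius) simp
  then have "Bseq (\<lambda>n. fps_nth v n * of_real r ^ n)"
    by (intro convergent_imp_Bseq convergentI[OF summable_LIMSEQ_zero])
  then obtain K where K: "\<And>n. norm (fps_nth v n * of_real r ^ n) \<le> K"
    unfolding Bseq_def by blast
  then have v: "norm (fps_nth v n) * r ^ n \<le> K" for n
    using rpos by (simp add: norm_mult norm_power)
  obtain N where N: "\<And>k. k > N \<Longrightarrow> K * real k < norm (poly quartic (s + of_nat k) + c)"
    using quartic_growth[of K s c] by blast
  define C where "C = Max ((\<lambda>k. norm (fps_nth f k) * r ^ k) ` {..N})"
  have f: "norm (fps_nth f k) * r ^ k \<le> C" for k
  proof (induction k rule: less_induct)
    case (less k)
    show ?case
    proof (cases "k \<le> N")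
      case True
      then show ?thesis unfolding C_def by (intro Max_ge) auto
    next
      case False
      have C0: "C \<ge> 0"
      proof -
        have "0 \<le> norm (fps_nth f 0) * r ^ 0" by simp
        also have "\<dots> \<le> C" using False by (intro less) simp
        finally show ?thesis .
      qed
      have K0: "K \<ge> 0" using norm_ge_zero[of "fps_nth v 0 * of_real r ^ 0"] K[of 0] by (rule order_trans)
      let ?Q = "poly quartic (s + of_nat k) + c"
      have Qf: "?Q * fps_nth f k = - (\<Sum>i<k. fps_nth v (k - i) * fps_nth f i)"
        using sol[of k] unfolding act_euler_symbol by (simp add: eq_neg_iff_add_eq_0)
      have "norm ?Q * (norm (fps_nth f k) * r ^ k) = norm (\<Sum>i<k. fps_nth v (k - i) * fps_nth f i) * r ^ k"
        using arg_cong[OF Qf, of norm] by (simp add: norm_mult)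
      also have "\<dots> \<le> (\<Sum>i<k. norm (fps_nth v (k - i) * fps_nth f i)) * r ^ k"
        using rpos by (intro mult_right_mono norm_sum) auto
      also have "\<dots> = (\<Sum>i<k. (norm (fps_nth v (k - i)) * r ^ (k - i)) * (norm (fps_nth f i) * r ^ i))"
        unfolding sum_distrib_right
      proof (intro sum.cong refl)
        fix i assume "i \<in> {..<k}"
        then have "r ^ k = r ^ (k - i) * r ^ i" by (simp flip: power_add)
        then show "norm (fps_nth v (k - i) * fps_nth f i) * r ^ k
          = norm (fps_nth v (k - i)) * r ^ (k - i) * (norm (fps_nth f i) * r ^ i)"
          by (simp add: norm_mult)
      qed
      also have "\<dots> \<le> (\<Sum>i<k. K * C)"
        using v less K0 rpos by (intro sum_mono mult_mono) auto
      also have "\<dots> = (K * real k) * C" by simp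
      also have "\<dots> \<le> norm ?Q * C"
        using N[of k] False C0 by (intro mult_right_mono) auto
      finally have "norm ?Q * (norm (fps_nth f k) * r ^ k) \<le> norm ?Q * C" .
      moreover have "norm ?Q > 0"
        using N[of k] False K0 by (metis le_less_trans linorder_not_le mult_nonneg_nonneg of_nat_0_le_iff)
      ultimately show ?thesis by simp
    qed
  qed
  have "summable (\<lambda>n. norm (fps_nth f n) * r0 ^ n)"
    by (rule Abel_lemma[OF _ r(1) f]) (use r0 in auto)
  then have "summable (\<lambda>n. norm (fps_nth f n * of_real r0 ^ n))"
    using r0(1) by (simp add: norm_mult norm_power)
  then show "summable (\<lambda>n. fps_nth f n * of_real r0 ^ n)"
    by (rule summable_norm_cancel)
qed

text \<open>
  The series that corresponds to multiplying the coefficient of x^(\<sigma>+k) by the falling factorial of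
  \<sigma> + k; it is written through \<sigma> - j + x d so that its convergence is evident.
\<close>
primrec theta_falling :: "complex \<Rightarrow> complex fps \<Rightarrow> nat \<Rightarrow> complex fps" where
  "theta_falling \<sigma> f 0 = f"
| "theta_falling \<sigma> f (Suc j) = fps_const (\<sigma> - of_nat j) * theta_falling \<sigma> f j
     + fps_X * fps_deriv (theta_falling \<sigma> f j)"

lemma theta_falling_nth:
  "fps_nth (theta_falling \<sigma> f j) k = poly (falling j) (\<sigma> + of_nat k) * fps_nth f k"
proof (induction j)
  case (Suc j)
  have "fps_nth (fps_X * fps_deriv (theta_falling \<sigma> f j)) k = of_nat k * fps_nth (theta_falling \<sigma> f j) k"
    by (cases k) auto
  then show ?case using Suc by (simp add: algebra_simps)
qed simp

lemma conv_radius_theta_falling: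
  "fps_conv_radius f \<le> fps_conv_radius (theta_falling \<sigma> f j)"
proof (induction j)
  case (Suc j)
  let ?g = "theta_falling \<sigma> f j"
  have "fps_conv_radius f \<le> min (fps_conv_radius (fps_const (\<sigma> - of_nat j))) (fps_conv_radius ?g)"
    using Suc by simp
  then have 1: "fps_conv_radius f \<le> fps_conv_radius (fps_const (\<sigma> - of_nat j) * ?g)"
    using fps_conv_radius_mult order_trans by blast
  have "fps_conv_radius f \<le> min (fps_conv_radius fps_X) (fps_conv_radius (fps_deriv ?g))"
    using order_trans[OF Suc fps_conv_radius_deriv] by simp
  then have 2: "fps_conv_radius f \<le> fps_conv_radius (fps_X * fps_deriv ?g)"
    using fps_conv_radius_mult order_trans by blast
  have "fps_conv_radius f \<le> min (fps_conv_radius (fps_const (\<sigma> - of_nat j) * ?g)) (fps_conv_radius (fps_X * fps_deriv ?g))"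
    using 1 2 by simp
  then show ?case using fps_conv_radius_add order_trans by (fastforce simp del: min.bounded_iff)
qed simp

text \<open>
  E is a branch of x^\<sigma>; only its differential equation matters. For \<sigma> = 0 and E = 1 this also
  covers power series solutions at an ordinary point.
\<close>
lemma higher_deriv_frobenius:
  assumes U: "open U" "U \<subseteq> ball a \<rho> - {a}" and \<rho>: "ereal \<rho> \<le> fps_conv_radius f"
    and E: "\<And>x. x \<in> U \<Longrightarrow> (E has_field_derivative \<sigma> / (x - a) * E x) (at x)"
    and "x \<in> U"
  shows "(deriv ^^ j) (\<lambda>x. E x * eval_fps f (x - a)) x
    = E x / (x - a) ^ j * eval_fps (theta_falling \<sigma> f j) (x - a)"
  using \<open>x \<in> U\<close>
proof (induction j arbitrary: x)
  case (Suc j)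
  let ?T = "theta_falling \<sigma> f j"
  have x: "x \<noteq> a" using Suc.prems U by auto
  have "norm (x - a) < \<rho>" using Suc.prems U by (auto simp: dist_norm norm_minus_commute)
  then have "ereal (norm (x - a)) < ereal \<rho>" by simp
  also have "\<dots> \<le> fps_conv_radius ?T" using \<rho> conv_radius_theta_falling order_trans by blast
  finally have conv: "ereal (norm (x - a)) < fps_conv_radius ?T" .
  then have conv': "ereal (norm (x - a)) < fps_conv_radius (fps_deriv ?T)"
    using fps_conv_radius_deriv less_le_trans by blast
  have "eventually (\<lambda>x. x \<in> U) (nhds x)" using U(1) Suc.prems by (rule eventually_nhds_in_open)
  then have "eventually (\<lambda>x. (deriv ^^ j) (\<lambda>x. E x * eval_fps f (x - a)) x
      = E x / (x - a) ^ j * eval_fps ?T (x - a)) (nhds x)"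
    by eventually_elim (rule Suc.IH)
  then have "(deriv ^^ Suc j) (\<lambda>x. E x * eval_fps f (x - a)) x
      = deriv (\<lambda>x. E x / (x - a) ^ j * eval_fps ?T (x - a)) x"
    by (simp add: deriv_cong_ev)
  also have "\<dots> = E x / (x - a) ^ Suc j * ((\<sigma> - of_nat j) * eval_fps ?T (x - a)
      + (x - a) * eval_fps (fps_deriv ?T) (x - a))"
  proof (rule DERIV_imp_deriv)
    have 1: "((\<lambda>x. eval_fps ?T (x - a)) has_field_derivative eval_fps (fps_deriv ?T) (x - a) * 1) (at x)"
      by (rule DERIV_chain2[where f = "eval_fps ?T" and g = "\<lambda>x. x - a"])
         (rule has_field_derivative_eval_fps[OF conv], auto intro!: derivative_eq_intros)
    have 2: "((\<lambda>x. (x - a) ^ j) has_field_derivative of_nat j * (x - a) ^ j / (x - a)) (at x)"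
    proof -
      have "((\<lambda>x. (x - a) ^ j) has_field_derivative of_nat j * (1 * (x - a) ^ (j - Suc 0))) (at x)"
        by (rule DERIV_power) (auto intro!: derivative_eq_intros)
      also have "of_nat j * (1 * (x - a) ^ (j - Suc 0)) = of_nat j * (x - a) ^ j / (x - a)"
        using x by (cases j) auto
      finally show ?thesis .
    qed
    have "((\<lambda>x. E x / (x - a) ^ j * eval_fps ?T (x - a)) has_field_derivative
       (\<sigma> / (x - a) * E x * (x - a) ^ j - E x * (of_nat j * (x - a) ^ j / (x - a))) / ((x - a) ^ j * (x - a) ^ j)
         * eval_fps ?T (x - a) + eval_fps (fps_deriv ?T) (x - a) * 1 * (E x / (x - a) ^ j)) (at x)"
      by (intro DERIV_mult DERIV_divide E 1 2 Suc.prems) (use x in simp)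
    also have "(\<sigma> / (x - a) * E x * (x - a) ^ j - E x * (of_nat j * (x - a) ^ j / (x - a))) / ((x - a) ^ j * (x - a) ^ j)
         * eval_fps ?T (x - a) + eval_fps (fps_deriv ?T) (x - a) * 1 * (E x / (x - a) ^ j)
       = E x / (x - a) ^ Suc j * ((\<sigma> - of_nat j) * eval_fps ?T (x - a)
          + (x - a) * eval_fps (fps_deriv ?T) (x - a))"
    proof -
      have "(\<sigma> / y * e * w - e * (n * w / y)) / (w * w) * t + d * 1 * (e / w)
          = e / (y * w) * ((\<sigma> - n) * t + y * d)" if "y \<noteq> 0" "w \<noteq> 0" for y w e n t d :: complex
        using that by (simp add: field_simps)
      from this[of "x - a" "(x - a) ^ j"] x show ?thesis by simp
    qed
    finally show "((\<lambda>x. E x / (x - a) ^ j * eval_fps ?T (x - a)) has_field_derivative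
       E x / (x - a) ^ Suc j * ((\<sigma> - of_nat j) * eval_fps ?T (x - a)
          + (x - a) * eval_fps (fps_deriv ?T) (x - a))) (at x)" .
  qed
  also have "(\<sigma> - of_nat j) * eval_fps ?T (x - a) + (x - a) * eval_fps (fps_deriv ?T) (x - a)
      = eval_fps (theta_falling \<sigma> f (Suc j)) (x - a)"
  proof -
    have "ereal (norm (x - a)) < fps_conv_radius (fps_const (\<sigma> - of_nat j) * ?T)"
      by (rule less_le_trans[OF _ fps_conv_radius_mult]) (use conv in simp)
    moreover have "ereal (norm (x - a)) < fps_conv_radius (fps_X * fps_deriv ?T)"
      by (rule less_le_trans[OF _ fps_conv_radius_mult]) (use conv' in simp)
    ultimately show ?thesis using conv conv' by (simp add: eval_fps_add eval_fps_mult)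
  qed
  finally show ?case .
qed simp

lemma frobenius_solution:
  fixes V f :: "complex fps"
  assumes U: "open U" "U \<subseteq> ball a \<rho> - {a}" and \<rho>: "ereal \<rho> \<le> fps_conv_radius V"
    and E: "\<And>x. x \<in> U \<Longrightarrow> (E has_field_derivative \<sigma> / (x - a) * E x) (at x)"
    and V: "\<And>x. x \<in> U \<Longrightarrow> (x - a) ^ 4 * (u x - lam) = eval_fps V (x - a)"
    and sol: "\<And>k. act (euler_symbol (\<lambda>s. poly quartic s + fps_nth V 0) (fps_nth V)) \<sigma> (fps_nth f) k = 0"
  shows "(\<lambda>x. E x * eval_fps f (x - a)) \<in> eigenfunctions (L4 u) lam U"
proof -
  have \<rho>f: "ereal \<rho> \<le> fps_conv_radius f"
    using \<rho> frobenius_series_converges[OF sol] by (rule order_trans)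
  have conv: "ereal (norm (x - a)) < fps_conv_radius g" if "x \<in> U" "ereal \<rho> \<le> fps_conv_radius g" for x g
  proof -
    have "ereal (norm (x - a)) < ereal \<rho>" using that(1) U by (auto simp: dist_norm norm_minus_commute)
    then show ?thesis using that(2) by (rule less_le_trans)
  qed
  have eq: "theta_falling \<sigma> f 4 = - (V * f)"
  proof (rule fps_ext)
    fix k
    have "fps_nth (f * V) k = (\<Sum>i\<le>k. fps_nth f i * fps_nth V (k - i))"
      by (simp add: fps_mult_nth atLeast0AtMost)
    also have "\<dots> = fps_nth V 0 * fps_nth f k + (\<Sum>i<k. fps_nth V (k - i) * fps_nth f i)"
      by (simp add: lessThan_Suc_atMost[symmetric] mult.commute)
    finally have Vf: "fps_nth (V * f) k = fps_nth V 0 * fps_nth f k + (\<Sum>i<k. fps_nth V (k - i) * fps_nth f i)"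
      by (simp only: mult.commute[of V])
    have "poly quartic (\<sigma> + of_nat k) * fps_nth f k + fps_nth (V * f) k = 0"
      using sol[of k] unfolding act_euler_symbol Vf by (simp only: distrib_right add.assoc)
    then show "fps_nth (theta_falling \<sigma> f 4) k = fps_nth (- (V * f)) k"
      by (simp add: theta_falling_nth falling_4 eq_neg_iff_add_eq_0)
  qed
  have "(deriv ^^ 4) (\<lambda>x. E x * eval_fps f (x - a)) x = (lam - u x) * (E x * eval_fps f (x - a))"
    if x: "x \<in> U" for x
  proof -
    have "x \<noteq> a" using x U by auto
    have "eval_fps (theta_falling \<sigma> f 4) (x - a) = - (eval_fps V (x - a) * eval_fps f (x - a))"
      unfolding eq using conv[OF x \<rho>] conv[OF x \<rho>f]
      by (subst eval_fps_minus) (auto simp: eval_fps_mult intro: less_le_trans[OF _ fps_conv_radius_mult])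
    also have "\<dots> = (x - a) ^ 4 * ((lam - u x) * eval_fps f (x - a))"
      unfolding V[OF x, symmetric] by (simp add: algebra_simps)
    finally show ?thesis
      using higher_deriv_frobenius[OF U \<rho>f E x, of 4] \<open>x \<noteq> a\<close> by simp
  qed
  moreover have "(\<lambda>x. E x * eval_fps f (x - a)) holomorphic_on U"
  proof (rule holomorphic_on_mult)
    show "E holomorphic_on U" unfolding holomorphic_on_open[OF U(1)] using E by blast
    have "eval_fps f holomorphic_on (\<lambda>x. x - a) ` U"
      by (rule holomorphic_on_eval_fps) (use conv[OF _ \<rho>f] in auto)
    then show "(\<lambda>x. eval_fps f (x - a)) holomorphic_on U"
      using holomorphic_on_compose[of "\<lambda>x. x - a" U "eval_fps f"]
      by (simp add: o_def holomorphic_on_diff)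
  qed
  ultimately show ?thesis unfolding eigenfunctions_L4_iff by blast
qed

section \<open>Independence of the Frobenius solutions\<close>

lemma log_branch_has_derivative:
  assumes "open U" "l holomorphic_on U" "\<And>x. x \<in> U \<Longrightarrow> exp (l x) = x - a" "x \<in> U"
  shows "(l has_field_derivative 1 / (x - a)) (at x)"
proof -
  have l: "(l has_field_derivative deriv l x) (at x)"
    using assms by (intro holomorphic_derivI)
  have "((\<lambda>x. exp (l x)) has_field_derivative exp (l x) * deriv l x) (at x)"
    by (rule DERIV_chain2[OF DERIV_exp l])
  moreover have "((\<lambda>x. exp (l x)) has_field_derivative 1) (at x)"
    by (rule has_field_derivative_transform_within_open[of "\<lambda>x. x - a" _ _ U])
       (use assms in \<open>auto intro!: derivative_eq_intros\<close>)
  ultimately have "(x - a) * deriv l x = 1" using DERIV_unique assms by metis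
  then have "deriv l x = 1 / (x - a)" by (metis eq_divide_eq mult.commute mult_zero_left zero_neq_one)
  then show ?thesis using l by simp
qed

text \<open>
  Differentiating the relation and eliminating x^\<tau> leaves
  \<tau> A B + x (A' B - A B') = 0 near a, without any branch. If A and B had the orders i and j at a,
  then the coefficient of x^(i+j) would be \<tau> + i - j times a nonzero number.
\<close>
lemma power_relation_trivial:
  assumes U: "open U" "U \<noteq> {}" "U \<subseteq> ball a \<rho> - {a}"
    and l: "l holomorphic_on U" "\<And>x. x \<in> U \<Longrightarrow> exp (l x) = x - a"
    and hol: "A holomorphic_on ball a \<rho>" "B holomorphic_on ball a \<rho>"
    and rel: "\<And>x. x \<in> U \<Longrightarrow> exp (\<tau> * l x) * A x + B x = 0"
    and \<tau>: "\<tau> \<notin> \<int>"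
  shows "(\<forall>x\<in>ball a \<rho>. A x = 0) \<and> (\<forall>x\<in>ball a \<rho>. B x = 0)"
proof -
  have sub: "U \<subseteq> ball a \<rho>" using U by blast
  then have \<rho>: "\<rho> > 0" using U(2) by (metis all_not_in_conv centre_in_ball dist_le_zero_iff linorder_not_le mem_ball order_less_le_trans subset_iff zero_le_dist)
  have ident: "\<forall>x\<in>ball a \<rho>. h x = 0" if "h holomorphic_on ball a \<rho>" "\<And>x. x \<in> U \<Longrightarrow> h x = 0" for h
    using analytic_continuation_open[OF U(1) open_ball U(2) connected_ball sub that(1), of "\<lambda>_. 0"] that(2) by auto
  have fromB: "\<forall>x\<in>ball a \<rho>. A x = 0" if "\<forall>x\<in>ball a \<rho>. B x = 0"
    by (rule ident[OF hol(1)]) (use rel that sub in force)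
  have fromA: "\<forall>x\<in>ball a \<rho>. B x = 0" if "\<forall>x\<in>ball a \<rho>. A x = 0"
    by (rule ident[OF hol(2)]) (use rel that sub in force)
  define H where "H = (\<lambda>x. \<tau> * A x * B x + (x - a) * (deriv A x * B x - A x * deriv B x))"
  have H_hol: "H holomorphic_on ball a \<rho>"
    unfolding H_def by (intro holomorphic_intros hol) auto
  have "H x = 0" if x: "x \<in> U" for x
  proof -
    have xa: "x \<noteq> a" using x U by auto
    have dA: "(A has_field_derivative deriv A x) (at x)" and dB: "(B has_field_derivative deriv B x) (at x)"
      using hol x sub by (auto intro!: holomorphic_derivI[of _ "ball a \<rho>"])
    have dl: "((\<lambda>x. \<tau> * l x) has_field_derivative \<tau> * (1 / (x - a))) (at x)"
      by (intro DERIV_cmult log_branch_has_derivative[OF U(1) l x])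
    have "((\<lambda>x. exp (\<tau> * l x) * A x + B x) has_field_derivative
        (exp (\<tau> * l x) * (\<tau> * (1 / (x - a))) * A x + deriv A x * exp (\<tau> * l x)) + deriv B x) (at x)"
      by (intro DERIV_add DERIV_mult dA dB DERIV_chain2[OF DERIV_exp dl])
    moreover have "((\<lambda>x. exp (\<tau> * l x) * A x + B x) has_field_derivative 0) (at x)"
      by (rule has_field_derivative_transform_within_open[of "\<lambda>_. 0" _ _ U]) (use U x rel in auto)
    ultimately have "exp (\<tau> * l x) * (\<tau> * (1 / (x - a))) * A x + deriv A x * exp (\<tau> * l x) + deriv B x = 0"
      using DERIV_unique by blast
    then have "exp (\<tau> * l x) * (\<tau> * A x + (x - a) * deriv A x) + (x - a) * deriv B x = 0"
      using xa by (simp add: field_simps)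
    then have "A x * (exp (\<tau> * l x) * (\<tau> * A x + (x - a) * deriv A x) + (x - a) * deriv B x) = 0"
      by simp
    moreover have "exp (\<tau> * l x) * A x = - B x" using rel[OF x] by (simp add: eq_neg_iff_add_eq_0)
    ultimately have "- B x * (\<tau> * A x + (x - a) * deriv A x) + (x - a) * deriv B x * A x = 0"
      by (metis (no_types, lifting) distrib_left mult.assoc mult.commute)
    then show ?thesis unfolding H_def by (simp add: algebra_simps)
  qed
  then have H0: "\<forall>x\<in>ball a \<rho>. H x = 0" by (rule ident[OF H_hol])
  have an: "h analytic_on {a}" if "h holomorphic_on ball a \<rho>" for h
    using that \<rho> by (meson analytic_at centre_in_ball open_ball)
  define FA where "FA = fps_expansion A a"
  define FB where "FB = fps_expansion B a"
  have FA: "(\<lambda>x. A (a + x)) has_fps_expansion FA" and FB: "(\<lambda>x. B (a + x)) has_fps_expansion FB"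
    unfolding FA_def FB_def by (intro analytic_at_imp_has_fps_expansion an hol)+
  have d: "(\<lambda>x. deriv h (a + x)) has_fps_expansion fps_deriv F"
    if "(\<lambda>x. h (a + x)) has_fps_expansion F" for h F
  proof -
    have "deriv (\<lambda>x. h (a + x)) = (\<lambda>x. deriv h (a + x))"
      unfolding deriv_def using DERIV_shift[of h _ _ a] by (auto simp: add.commute fun_eq_iff)
    then show ?thesis using has_fps_expansion_deriv[OF that] by simp
  qed
  have "(\<lambda>x. \<tau> * A (a + x) * B (a + x) + x * (deriv A (a + x) * B (a + x) - A (a + x) * deriv B (a + x)))
      has_fps_expansion fps_const \<tau> * FA * FB + fps_X * (fps_deriv FA * FB - FA * fps_deriv FB)"
    by (intro fps_expansion_intros FA FB d)
  moreover have "eventually (\<lambda>x. x \<in> ball 0 \<rho>) (nhds (0::complex))"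
    using \<rho> by (intro eventually_nhds_in_open) auto
  then have "eventually (\<lambda>x. \<tau> * A (a + x) * B (a + x)
      + x * (deriv A (a + x) * B (a + x) - A (a + x) * deriv B (a + x)) = 0) (nhds 0)"
  proof eventually_elim
    case (elim x)
    then have "H (a + x) = 0" by (intro H0[rule_format]) (simp add: dist_norm)
    then show ?case by (simp add: H_def)
  qed
  then have "(\<lambda>x. \<tau> * A (a + x) * B (a + x)
      + x * (deriv A (a + x) * B (a + x) - A (a + x) * deriv B (a + x))) has_fps_expansion 0"
    by (simp add: has_fps_expansion_0_iff)
  ultimately have "fps_const \<tau> * FA * FB + fps_X * (fps_deriv FA * FB - FA * fps_deriv FB) = 0"
    by (rule fps_expansion_unique_complex)
  then have fps_eq: "fps_const \<tau> * (FA * FB) + ((fps_X * fps_deriv FA) * FB - FA * (fps_X * fps_deriv FB)) = 0"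
    by (simp add: algebra_simps)
  have "FA = 0 \<or> FB = 0"
  proof (rule ccontr)
    assume "\<not> ?thesis"
    then have nz: "FA \<noteq> 0" "FB \<noteq> 0" by auto
    define i j where "i = subdegree FA" and "j = subdegree FB"
    have X: "fps_nth (fps_X * fps_deriv F) k = of_nat k * fps_nth F k" for F :: "complex fps" and k
      by (cases k) auto
    have prod: "fps_nth (f * g) (i + j) = fps_nth f i * fps_nth g j"
      if "\<And>k. k < i \<Longrightarrow> fps_nth f k = 0" "\<And>k. k < j \<Longrightarrow> fps_nth g k = 0" for f g :: "complex fps"
    proof -
      have "fps_nth (f * g) (i + j) = (\<Sum>k\<in>{0..i + j}. fps_nth f k * fps_nth g (i + j - k))"
        by (simp add: fps_mult_nth)
      also have "\<dots> = (\<Sum>k\<in>{i}. fps_nth f k * fps_nth g (i + j - k))"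
      proof (rule sum.mono_neutral_right)
        show "\<forall>k\<in>{0..i + j} - {i}. fps_nth f k * fps_nth g (i + j - k) = 0"
        proof
          fix k assume "k \<in> {0..i + j} - {i}"
          then have "k < i \<or> i + j - k < j" by auto
          then show "fps_nth f k * fps_nth g (i + j - k) = 0" using that by auto
        qed
      qed auto
      finally show ?thesis by simp
    qed
    have low: "\<And>k. k < i \<Longrightarrow> fps_nth FA k = 0" "\<And>k. k < j \<Longrightarrow> fps_nth FB k = 0"
      unfolding i_def j_def by auto
    have "fps_nth (fps_const \<tau> * (FA * FB) + ((fps_X * fps_deriv FA) * FB - FA * (fps_X * fps_deriv FB))) (i + j)
      = \<tau> * (fps_nth FA i * fps_nth FB j) + (of_nat i * fps_nth FA i * fps_nth FB j - fps_nth FA i * (of_nat j * fps_nth FB j))"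
      using prod[OF low] prod[of "fps_X * fps_deriv FA" FB] prod[of FA "fps_X * fps_deriv FB"] low X
      by simp
    then have "(\<tau> + of_nat i - of_nat j) * (fps_nth FA i * fps_nth FB j) = 0"
      unfolding fps_eq by (simp add: algebra_simps)
    moreover have "fps_nth FA i \<noteq> 0" "fps_nth FB j \<noteq> 0" using nz unfolding i_def j_def by auto
    ultimately have "\<tau> + of_nat i - of_nat j = 0" by (simp only: mult_eq_0_iff) simp
    then have "\<tau> = of_int (int j - int i)" by (simp add: algebra_simps eq_diff_eq)
    then show False using \<tau> by (metis Ints_of_int)
  qed
  moreover have zero: "\<forall>x\<in>ball a \<rho>. h x = 0"
    if "(\<lambda>x. h (a + x)) has_fps_expansion 0" "h holomorphic_on ball a \<rho>" for h
  proof -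
    have "eventually (\<lambda>x. h (a + x) = 0) (nhds 0)" using that(1) by (simp add: has_fps_expansion_0_iff)
    then obtain e where e: "e > 0" "\<And>x. dist x 0 < e \<Longrightarrow> h (a + x) = 0"
      unfolding eventually_nhds_metric by blast
    define e' where "e' = min e \<rho>"
    have "h x = 0" if "x \<in> ball a e'" for x
      using e(2)[of "x - a"] that by (simp add: e'_def dist_norm norm_minus_commute)
    moreover have "ball a e' \<noteq> {}" "ball a e' \<subseteq> ball a \<rho>"
      using e(1) \<rho> by (auto simp: e'_def)
    ultimately show ?thesis
      using analytic_continuation_open[OF open_ball open_ball _ connected_ball _ that(2), of a e' "\<lambda>_. 0"]
      by simp
  qed
  ultimately show ?thesis using FA FB hol fromA fromB by blast
qed

lemma pair_relation_trivial:
  assumes "\<rho> > 0" "K > 0" and hol: "G holomorphic_on ball a \<rho>" "H holomorphic_on ball a \<rho>"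
    and nz: "G a \<noteq> 0" "H a \<noteq> 0"
    and rel: "\<And>x. x \<in> ball a \<rho> \<Longrightarrow> c * G x + d * ((x - a) ^ K * H x) = 0"
  shows "c = 0 \<and> d = 0"
proof -
  have c: "c = 0" using rel[of a] assms by (simp add: zero_power)
  have "d = 0"
  proof (rule ccontr)
    assume "d \<noteq> 0"
    have 0: "H x = 0" if "x \<in> ball a \<rho> - {a}" for x
      using rel[of x] that c \<open>d \<noteq> 0\<close> by auto
    have "a + of_real (\<rho> / 2) \<in> ball a \<rho> - {a}" using assms(1) by (simp add: dist_norm)
    then have "ball a \<rho> - {a} \<noteq> {}" by blast
    then have "H a = 0"
      using analytic_continuation_open[of "ball a \<rho> - {a}" "ball a \<rho>" H "\<lambda>_. 0" a] 0 hol(2) assms(1)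
      by auto
    then show False using nz by simp
  qed
  then show ?thesis using c by simp
qed

lemma one_to_four: "{1..4} = {1, 2, 3, 4::nat}"
  by auto

text \<open>
  Exponents of the same pair differ by an integer, so they contribute single-valued factors;
  the two pairs are separated by power_relation_trivial.
\<close>
lemma frobenius_functions_independent:
  assumes U: "open U" "U \<noteq> {}" "U \<subseteq> ball a \<rho> - {a}"
    and l: "l holomorphic_on U" "\<And>x. x \<in> U \<Longrightarrow> exp (l x) = x - a"
    and G: "\<And>r. r \<in> {1..4} \<Longrightarrow> G r holomorphic_on ball a \<rho>" "\<And>r. r \<in> {1..4} \<Longrightarrow> G r a \<noteq> 0"
    and \<sigma>: "\<sigma> 3 = \<sigma> 1 + of_nat K" "\<sigma> 4 = \<sigma> 2 + of_nat K" "K > 0" "\<sigma> 1 - \<sigma> 2 \<notin> \<int>"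
    and rel: "\<And>x. x \<in> U \<Longrightarrow> (\<Sum>r\<in>{1..4::nat}. c r * (exp (\<sigma> r * l x) * G r x)) = 0"
  shows "\<forall>r\<in>{1..4}. c r = 0"
proof -
  have \<rho>: "\<rho> > 0" using U by (metis Diff_iff all_not_in_conv ball_eq_empty linorder_not_le subset_iff)
  define A where "A = (\<lambda>x. c 1 * G 1 x + c 3 * ((x - a) ^ K * G 3 x))"
  define B where "B = (\<lambda>x. c 2 * G 2 x + c 4 * ((x - a) ^ K * G 4 x))"
  have hol: "A holomorphic_on ball a \<rho>" "B holomorphic_on ball a \<rho>"
    unfolding A_def B_def by (intro holomorphic_intros G; simp)+
  have "exp ((\<sigma> 1 - \<sigma> 2) * l x) * A x + B x = 0" if "x \<in> U" for x
  proof -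
    have e: "exp (\<sigma> 3 * l x) = exp (\<sigma> 1 * l x) * (x - a) ^ K"
      "exp (\<sigma> 4 * l x) = exp (\<sigma> 2 * l x) * (x - a) ^ K"
      unfolding \<sigma> l(2)[OF that, symmetric] by (simp_all add: ring_distribs exp_add exp_of_nat_mult)
    have "c 1 * (exp (\<sigma> 1 * l x) * G 1 x) + (c 2 * (exp (\<sigma> 2 * l x) * G 2 x)
        + (c 3 * (exp (\<sigma> 3 * l x) * G 3 x) + c 4 * (exp (\<sigma> 4 * l x) * G 4 x))) = 0"
      using rel[OF that] unfolding one_to_four by simp
    then have "exp (\<sigma> 1 * l x) * A x + exp (\<sigma> 2 * l x) * B x = 0"
      unfolding e A_def B_def by (simp add: algebra_simps)
    then have "exp (\<sigma> 2 * l x) * (exp ((\<sigma> 1 - \<sigma> 2) * l x) * A x + B x) = 0"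
      by (simp add: ring_distribs exp_diff)
    then show ?thesis by simp
  qed
  from power_relation_trivial[OF U l hol this \<sigma>(4)]
  have "\<forall>x\<in>ball a \<rho>. A x = 0" "\<forall>x\<in>ball a \<rho>. B x = 0" by auto
  then have "c 1 = 0 \<and> c 3 = 0" "c 2 = 0 \<and> c 4 = 0"
    using pair_relation_trivial[OF \<rho> \<sigma>(3) G(1)[of 1] G(1)[of 3] G(2)[of 1] G(2)[of 3], of "c 1" "c 3"]
      pair_relation_trivial[OF \<rho> \<sigma>(3) G(1)[of 2] G(1)[of 4] G(2)[of 2] G(2)[of 4], of "c 2" "c 4"]
    unfolding A_def B_def by auto
  then show ?thesis unfolding one_to_four by simp
qed

text \<open>
  The symbol of d^4 + u - lam at a point where u has the Laurent expansion F. The subtraction at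
  k = 4 is the constant term of F minus lam.
\<close>
definition local_symbol :: "complex fls \<Rightarrow> complex \<Rightarrow> nat \<Rightarrow> complex \<Rightarrow> complex" where
  "local_symbol F lam = euler_symbol (\<lambda>s. poly quartic s + fls_nth F (-4))
     (\<lambda>k. fls_nth F (int k - 4) - (if k = 4 then lam else 0))"

text \<open>
  Only near a are the Laurent series of u and u itself interchangeable, so the radius \<rho> is the
  smallest of three: where the expansion converges, where it represents u, and where u has no other
  singularity.
\<close>
theorem frobenius_basis:
  fixes \<sigma> :: "nat \<Rightarrow> complex" and a :: complex
  assumes u: "u meromorphic_on UNIV"
  defines "F \<equiv> laurent_expansion u a"
  assumes reg: "\<forall>i < -4. fls_nth F i = 0"
    and sols: "\<forall>r\<in>{1..4}. \<exists>f. f 0 \<noteq> 0 \<and> (\<forall>k. act (local_symbol F lam) (\<sigma> r) f k = 0)"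
    and \<sigma>: "\<sigma> 3 = \<sigma> 1 + of_nat K" "\<sigma> 4 = \<sigma> 2 + of_nat K" "K > 0" "\<sigma> 1 - \<sigma> 2 \<notin> \<int>"
  shows "\<exists>\<rho>>0. \<exists>G. u analytic_on (ball a \<rho> - {a}) \<and>
        (\<forall>r\<in>{1..4::nat}. G r holomorphic_on ball a \<rho> \<and> G r a \<noteq> 0) \<and>
        (\<forall>U l. open U \<and> connected U \<and> U \<noteq> {} \<and> U \<subseteq> ball a \<rho> - {a} \<and>
               l holomorphic_on U \<and> (\<forall>x\<in>U. exp (l x) = x - a) \<longrightarrow>
           basis_on U (eigenfunctions (L4 u) lam U) {1..4} (\<lambda>r x. exp (\<sigma> r * l x) * G r x))"
proof -
  define F' where "F' = fls_shift (-4) (F - fls_const lam)"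
  define V where "V = fls_regpart F'"
  have F'V: "F' = fps_to_fls V"
    unfolding V_def
    by (rule fls_eqI) (auto simp: F'_def reg)
  have V_nth: "fps_nth V k = fls_nth F (int k - 4) - (if k = 4 then lam else 0)" for k
    unfolding V_def F'_def by simp
  have "(\<lambda>x. u (a + x)) has_laurent_expansion F"
    unfolding F_def by (rule meromorphic_on_imp_has_laurent_expansion[OF u]) simp
  then have "(\<lambda>x. (u (a + x) - lam) * x powi 4) has_laurent_expansion F'"
    unfolding F'_def by (intro laurent_expansion_intros) auto
  then have conv: "fps_conv_radius V > 0"
    and ev: "eventually (\<lambda>x. eval_fls (fps_to_fls V) x = (u (a + x) - lam) * x ^ 4) (at 0)"
    unfolding has_laurent_expansion_def F'V by simp_all
  obtain e where e: "e > 0"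
    "\<And>x. x \<noteq> 0 \<Longrightarrow> dist x 0 < e \<Longrightarrow> eval_fls (fps_to_fls V) x = (u (a + x) - lam) * x ^ 4"
    using ev unfolding eventually_at by blast
  obtain \<rho>1 where "0 < ereal \<rho>1" "ereal \<rho>1 < fps_conv_radius V" using ereal_dense2[OF conv] by blast
  then have \<rho>1: "\<rho>1 > 0" "ereal \<rho>1 < fps_conv_radius V" by simp_all
  have "eventually (\<lambda>z. u analytic_on {z}) (at a)"
    using meromorphic_on_imp_analytic_cosparse[OF u] by (blast intro: eventually_cosparse_imp_eventually_at)
  then obtain \<rho>2 where \<rho>2: "\<rho>2 > 0" "\<And>z. z \<noteq> a \<Longrightarrow> dist z a < \<rho>2 \<Longrightarrow> u analytic_on {z}"
    unfolding eventually_at by blast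
  define \<rho> where "\<rho> = min e (min \<rho>1 \<rho>2)"
  have "\<rho> \<le> \<rho>1" unfolding \<rho>_def by simp
  then have "ereal \<rho> \<le> ereal \<rho>1" by simp
  then have \<rho>: "\<rho> > 0" "ereal \<rho> \<le> fps_conv_radius V"
    using e(1) \<rho>1 \<rho>2(1) unfolding \<rho>_def by auto
  have an: "u analytic_on (ball a \<rho> - {a})"
    by (subst analytic_on_analytic_at) (auto intro!: \<rho>2(2) simp: \<rho>_def dist_commute)
  have V: "(x - a) ^ 4 * (u x - lam) = eval_fps V (x - a)" if "x \<in> ball a \<rho> - {a}" for x
  proof -
    have d: "norm (x - a) < \<rho>" using that by (simp add: dist_norm norm_minus_commute)
    then have "ereal (norm (x - a)) < ereal \<rho>" by simp
    then have "ereal (norm (x - a)) < fps_conv_radius V" using \<rho>(2) by (rule less_le_trans)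
    then have "eval_fls (fps_to_fls V) (x - a) = eval_fps V (x - a)" by (rule eval_fps_to_fls)
    moreover have "eval_fls (fps_to_fls V) (x - a) = (u (a + (x - a)) - lam) * (x - a) ^ 4"
      by (rule e(2)) (use d that in \<open>auto simp: \<rho>_def\<close>)
    ultimately show ?thesis by (simp add: mult.commute)
  qed
  obtain f where f: "\<And>r. r \<in> {1..4} \<Longrightarrow> f r 0 \<noteq> 0"
      "\<And>r k. r \<in> {1..4} \<Longrightarrow> act (local_symbol F lam) (\<sigma> r) (f r) k = 0"
    using sols by metis
  define G where "G = (\<lambda>r x. eval_fps (Abs_fps (f r)) (x - a))"
  have sol: "act (euler_symbol (\<lambda>s. poly quartic s + fps_nth V 0) (fps_nth V)) (\<sigma> r) (fps_nth (Abs_fps (f r))) k = 0"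
    if "r \<in> {1..4}" for r k
  proof -
    have "fps_nth V = (\<lambda>k. fls_nth F (int k - 4) - (if k = 4 then lam else 0))"
      using V_nth by blast
    moreover have "fps_nth (Abs_fps (f r)) = f r" by (simp add: fun_eq_iff)
    ultimately show ?thesis using f(2)[OF that] unfolding local_symbol_def by simp
  qed
  have \<rho>f: "ereal \<rho> \<le> fps_conv_radius (Abs_fps (f r))" if "r \<in> {1..4}" for r
    using \<rho>(2) frobenius_series_converges[OF sol[OF that]] by (rule order_trans)
  have G: "G r holomorphic_on ball a \<rho>" if "r \<in> {1..4}" for r
  proof -
    have "eval_fps (Abs_fps (f r)) holomorphic_on ball 0 \<rho>"
      by (rule holomorphic_on_eval_fps[OF ball_eball_mono[OF \<rho>f[OF that]]])
    then show ?thesis unfolding G_def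
      by (rule holomorphic_on_compose_gen[unfolded o_def, rotated])
         (auto intro!: holomorphic_intros simp: dist_norm norm_minus_commute)
  qed
  have Ga: "G r a \<noteq> 0" if "r \<in> {1..4}" for r
    unfolding G_def using f(1)[OF that] by (simp add: eval_fps_at_0)
  have "basis_on U (eigenfunctions (L4 u) lam U) {1..4} (\<lambda>r x. exp (\<sigma> r * l x) * G r x)"
    if U: "open U" "connected U" "U \<noteq> {}" "U \<subseteq> ball a \<rho> - {a}"
      and l: "l holomorphic_on U" "\<And>x. x \<in> U \<Longrightarrow> exp (l x) = x - a" for U l
  proof (rule independent_eigenfunctions_basis[OF U(1-3)])
    show "u analytic_on U" using an U(4) by (rule analytic_on_subset)
    show "(\<lambda>x. exp (\<sigma> r * l x) * G r x) \<in> eigenfunctions (L4 u) lam U" if "r \<in> {1..4}" for r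
      unfolding G_def
    proof (rule frobenius_solution[OF U(1,4) \<rho>(2) _ _ sol[OF that]])
      fix x assume x: "x \<in> U"
      show "(x - a) ^ 4 * (u x - lam) = eval_fps V (x - a)" using V x U(4) by blast
      have "((\<lambda>x. exp (\<sigma> r * l x)) has_field_derivative exp (\<sigma> r * l x) * (\<sigma> r * (1 / (x - a)))) (at x)"
        by (intro DERIV_chain2[OF DERIV_exp] DERIV_cmult log_branch_has_derivative[OF U(1) l x])
      then show "((\<lambda>x. exp (\<sigma> r * l x)) has_field_derivative \<sigma> r / (x - a) * exp (\<sigma> r * l x)) (at x)"
        by (simp add: mult.commute)
    qed
    show "\<forall>i\<in>{1..4}. c i = 0" if "\<forall>z\<in>U. (\<Sum>i\<in>{1..4}. c i * (exp (\<sigma> i * l z) * G i z)) = 0" for c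
      by (rule frobenius_functions_independent[OF U(1,3,4) l G Ga \<sigma>]) (use that in auto)
  qed
  then show ?thesis using \<rho>(1) an G Ga by (intro exI[of _ \<rho>] conjI exI[of _ G]) auto
qed

section \<open>Analytic continuation of solutions\<close>

text \<open>
  An ordinary point is a Frobenius problem with the exponent 0 and the indicial polynomial
  s(s-1)(s-2)(s-3), whose resonances at 0, 1, 2, 3 are unobstructed and leave the four initial values
  free. The solution exists on the whole disc on which u is analytic, which makes uniform
  steps along a path possible.
\<close>
lemma ordinary_point_solution:
  assumes "u analytic_on ball q \<delta>" "\<delta> > 0"
  shows "\<exists>\<psi>\<in>eigenfunctions (L4 u) lam (ball q \<delta>). \<forall>j<4. (deriv ^^ j) \<psi> q = c j"
proof -
  define W where "W = fps_expansion (\<lambda>z. u z - lam) q"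
  have hol: "(\<lambda>z. u z - lam) holomorphic_on eball q \<delta>"
    using analytic_imp_holomorphic[OF assms(1)] by (auto intro!: holomorphic_intros)
  have W: "ereal \<delta> \<le> fps_conv_radius W" "\<And>z. z \<in> ball q \<delta> \<Longrightarrow> eval_fps W (z - q) = u z - lam"
    using conv_radius_fps_expansion[OF hol] eval_fps_expansion[OF hol] unfolding W_def by auto
  define V where "V = fps_X ^ 4 * W"
  have "min (fps_conv_radius (fps_X ^ 4 :: complex fps)) (fps_conv_radius W) \<le> fps_conv_radius V"
    unfolding V_def by (rule fps_conv_radius_mult)
  then have \<rho>: "ereal \<delta> \<le> fps_conv_radius V" using W(1) by (simp add: min_def split: if_splits)
  have V: "(x - q) ^ 4 * (u x - lam) = eval_fps V (x - q)" if "x \<in> ball q \<delta>" for x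
  proof -
    have "ereal (norm (x - q)) < fps_conv_radius W"
      by (rule less_le_trans[OF _ W(1)]) (use that in \<open>auto simp: dist_norm norm_minus_commute\<close>)
    then show ?thesis unfolding V_def using W(2)[OF that] by (simp add: eval_fps_mult)
  qed
  have V_low: "fps_nth V k = 0" if "k < 4" for k
    using that unfolding V_def by (simp add: fps_X_power_mult_nth)
  let ?Q = "\<lambda>s. poly quartic s + fps_nth V 0"
  have "?Q (0 + of_nat k) \<noteq> 0" if "3 < k" for k
  proof -
    have "of_nat k \<noteq> (1::complex)" "of_nat k \<noteq> (2::complex)" "of_nat k \<noteq> (3::complex)"
      using that of_nat_eq_iff[of k 1, where ?'a = complex] of_nat_eq_iff[of k 2, where ?'a = complex]
        of_nat_eq_iff[of k 3, where ?'a = complex] by auto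
    then show ?thesis using that V_low[of 0] unfolding poly_quartic by auto
  qed
  then obtain g where g: "\<And>k. k \<le> 3 \<Longrightarrow> g k = c k / fact k"
      "\<And>k. k > 3 \<Longrightarrow> act (euler_symbol ?Q (fps_nth V)) 0 g k = 0"
    using frobenius_coeff_solves[of 3 ?Q 0 "\<lambda>k. c k / fact k" "fps_nth V" "\<lambda>_. 0"] by blast
  define f where "f = Abs_fps g"
  have sol: "act (euler_symbol ?Q (fps_nth V)) 0 (fps_nth f) k = 0" for k
  proof (cases "k > 3")
    case True
    moreover have "fps_nth f = g" by (simp add: f_def fun_eq_iff)
    ultimately show ?thesis using g(2) by simp
  next
    case False
    then have "k = 0 \<or> k = 1 \<or> k = 2 \<or> k = 3" by linarith
    then have "?Q (0 + of_nat k) = 0" using V_low[of 0] unfolding poly_quartic by auto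
    moreover have "(\<Sum>i<k. fps_nth V (k - i) * fps_nth f i) = 0"
      using False V_low by (intro sum.neutral) auto
    ultimately show ?thesis unfolding act_euler_symbol by simp
  qed
  let ?\<psi> = "\<lambda>x. eval_fps f (x - q)"
  have \<rho>f: "ereal \<delta> \<le> fps_conv_radius f"
    using \<rho> frobenius_series_converges[OF sol] by (rule order_trans)
  have "(\<lambda>x. 1 * eval_fps f (x - q)) \<in> eigenfunctions (L4 u) lam (ball q \<delta> - {q})"
    by (rule frobenius_solution[OF _ order_refl \<rho> _ _ sol]) (use V in \<open>auto intro!: derivative_eq_intros\<close>)
  \<comment> \<open>The equation holds off the centre; the identity theorem adds the centre below.\<close>
  then have eig: "(deriv ^^ 4) ?\<psi> x = (lam - u x) * ?\<psi> x" if "x \<in> ball q \<delta> - {q}" for x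
    using that unfolding eigenfunctions_L4_iff by simp
  have hol_eval: "eval_fps f holomorphic_on ball 0 \<delta>"
    by (rule holomorphic_on_eval_fps[OF ball_eball_mono[OF \<rho>f]])
  have hol\<psi>: "?\<psi> holomorphic_on ball q \<delta>"
    by (rule holomorphic_on_compose_gen[OF _ hol_eval, unfolded o_def])
       (auto intro!: holomorphic_intros simp: dist_norm norm_minus_commute)
  have "(deriv ^^ 4) ?\<psi> x = (lam - u x) * ?\<psi> x" if "x \<in> ball q \<delta>" for x
  proof (rule analytic_continuation_open[of "ball q \<delta> - {q}" "ball q \<delta>" _ _ x])
    show "ball q \<delta> - {q} \<noteq> {}"
    proof -
      have "q + of_real (\<delta> / 2) \<in> ball q \<delta> - {q}" using assms(2) by (simp add: dist_norm)
      then show ?thesis by blast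
    qed
    show "(deriv ^^ 4) ?\<psi> holomorphic_on ball q \<delta>"
      by (rule holomorphic_higher_deriv[OF hol\<psi>]) simp
    show "(\<lambda>x. (lam - u x) * ?\<psi> x) holomorphic_on ball q \<delta>"
      using hol\<psi> analytic_imp_holomorphic[OF assms(1)] by (intro holomorphic_intros)
  qed (use eig that in auto)
  then have mem: "?\<psi> \<in> eigenfunctions (L4 u) lam (ball q \<delta>)"
    unfolding eigenfunctions_L4_iff using hol\<psi> by blast
  have "(deriv ^^ j) ?\<psi> q = c j" if "j < 4" for j
  proof -
    have "(deriv ^^ j) (\<lambda>w. eval_fps f (1 * w + (- q))) q = 1 ^ j * (deriv ^^ j) (eval_fps f) (1 * q + (- q))"
      by (rule higher_deriv_compose_linear'[OF hol_eval, of "ball q \<delta>"])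
         (use assms(2) in \<open>auto simp: dist_norm norm_minus_commute\<close>)
    also have "\<dots> = fact j * fps_nth f j"
    proof -
      have "fps_conv_radius f > 0" using \<rho>f assms(2) by (metis ereal_less(2) less_le_trans)
      then show ?thesis using fps_nth_conv_deriv[of f j] by simp
    qed
    also have "\<dots> = c j" using g(1)[of j] that by (simp add: f_def)
    finally show ?thesis by simp
  qed
  then show ?thesis using mem by blast
qed

lemma eigenfunctions_eqI:
  assumes W: "open W" "connected W" "u analytic_on W"
    and fg: "f \<in> eigenfunctions (L4 u) lam W" "h \<in> eigenfunctions (L4 u) lam W"
    and x0: "x0 \<in> W" "\<And>j. j < 4 \<Longrightarrow> (deriv ^^ j) f x0 = (deriv ^^ j) h x0" and "z \<in> W"
  shows "f z = h z"
proof -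
  have h: "f holomorphic_on W" "h holomorphic_on W" using fg by (auto simp: eigenfunctions_def)
  have d: "(deriv ^^ j) (\<lambda>x. f x - h x) x = (deriv ^^ j) f x - (deriv ^^ j) h x" if "x \<in> W" for j x
    by (rule higher_deriv_diff[OF h W(1) that])
  have "(\<lambda>x. f x - h x) \<in> eigenfunctions (L4 u) lam W"
    unfolding eigenfunctions_L4_iff
  proof (intro conjI ballI)
    fix z assume "z \<in> W"
    then show "(deriv ^^ 4) (\<lambda>x. f x - h x) z = (lam - u z) * (f z - h z)"
      using fg unfolding eigenfunctions_L4_iff by (simp only: d right_diff_distrib)
  qed (intro holomorphic_intros h)
  from eigenfunction_eq_0[OF W this x0(1) _ \<open>z \<in> W\<close>] d[OF x0(1)] x0(2) show ?thesis by simp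
qed

lemma higher_deriv_eq_0:
  fixes f :: "complex \<Rightarrow> complex"
  assumes "open S" "x \<in> S" "\<And>z. z \<in> S \<Longrightarrow> f z = 0"
  shows "(deriv ^^ j) f x = 0"
proof -
  have "f holomorphic_on S" using assms(3) by (simp cong: holomorphic_cong)
  then have "(deriv ^^ j) f x = (deriv ^^ j) (\<lambda>_. 0) x"
    by (rule higher_deriv_transform_within_open) (use assms in auto)
  then show ?thesis by simp
qed

text \<open>
  The path is cut into N pieces so short that each node lies in the disc of radius \<delta> about the
  preceding one, and solutions are transported from node to node by their jets. Neighbouring
  solutions agree on the intersection of their discs, which is convex. The last clause
  records that continuation is injective.
\<close>
lemma continue_eigenfunction_along_path:
  assumes D: "open D" "u analytic_on D"
    and \<gamma>: "path \<gamma>" "path_image \<gamma> \<subseteq> D"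
    and f: "open U" "pathstart \<gamma> \<in> U" "u analytic_on U" "f \<in> eigenfunctions (L4 u) lam U"
  shows "\<exists>\<delta>>0. \<exists>h. h \<in> eigenfunctions (L4 u) lam (ball (pathfinish \<gamma>) \<delta>) \<and> continues_along \<gamma> f h \<and>
     ((\<forall>z\<in>ball (pathfinish \<gamma>) \<delta>. h z = 0) \<longrightarrow> (\<forall>j<4. (deriv ^^ j) f (pathstart \<gamma>) = 0))"
proof -
  obtain \<delta> where \<delta>: "\<delta> > 0" "(\<Union>x\<in>path_image \<gamma>. ball x \<delta>) \<subseteq> D"
    using compact_subset_open_imp_ball_epsilon_subset[OF compact_path_image[OF \<gamma>(1)] D(1) \<gamma>(2)] by blast
  have an: "u analytic_on ball (\<gamma> t) \<delta>" if "t \<in> {0..1}" for t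
  proof -
    have "\<gamma> t \<in> path_image \<gamma>" using that by (simp add: path_image_def)
    then have "ball (\<gamma> t) \<delta> \<subseteq> D" using \<delta>(2) by blast
    then show ?thesis by (rule analytic_on_subset[OF D(2)])
  qed
  have "uniformly_continuous_on {0..1} \<gamma>"
    using \<gamma>(1) by (intro compact_uniformly_continuous) (auto simp: path_def)
  then obtain e where e: "e > 0" "\<And>s t. s \<in> {0..1} \<Longrightarrow> t \<in> {0..1} \<Longrightarrow> dist t s < e \<Longrightarrow> dist (\<gamma> t) (\<gamma> s) < \<delta>"
    unfolding uniformly_continuous_on_def using \<delta>(1) by metis
  obtain N :: nat where N: "N > 0" "1 / real N < e"
    using e(1) by (metis nat_approx_posE zero_less_Suc)
  have close: "dist (\<gamma> t) (\<gamma> s) < \<delta>" if "s \<in> {0..1}" "t \<in> {0..1}" "\<bar>t * N - s * N\<bar> \<le> 1" for s t :: real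
  proof (rule e(2)[OF that(1,2)])
    have "\<bar>t - s\<bar> * N \<le> 1" using that(3) by (simp add: abs_mult flip: left_diff_distrib)
    then have "\<bar>t - s\<bar> \<le> 1 / N" using N(1) by (simp add: pos_le_divide_eq)
    then show "dist t s < e" using N(2) by (simp add: dist_real_def)
  qed
  define q where "q = (\<lambda>k. \<gamma> (real k / N))"
  have node: "real k / N \<in> {0..1}" if "k \<le> N" for k using that N by simp
  define S where "S = (\<lambda>k c. SOME \<psi>. \<psi> \<in> eigenfunctions (L4 u) lam (ball (q k) \<delta>) \<and> (\<forall>j<4. (deriv ^^ j) \<psi> (q k) = c j))"
  have S: "S k c \<in> eigenfunctions (L4 u) lam (ball (q k) \<delta>) \<and> (\<forall>j<4. (deriv ^^ j) (S k c) (q k) = c j)"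
    if "k \<le> N" for k c
  proof -
    have "\<exists>\<psi>. \<psi> \<in> eigenfunctions (L4 u) lam (ball (q k) \<delta>) \<and> (\<forall>j<4. (deriv ^^ j) \<psi> (q k) = c j)"
      using ordinary_point_solution[OF an[OF node[OF that]] \<delta>(1), of lam c] unfolding q_def by blast
    then show ?thesis unfolding S_def by (rule someI_ex)
  qed
  define fs where "fs = rec_nat (S 0 (\<lambda>j. (deriv ^^ j) f (q 0))) (\<lambda>k g. S (Suc k) (\<lambda>j. (deriv ^^ j) g (q (Suc k))))"
  have fs0: "fs 0 = S 0 (\<lambda>j. (deriv ^^ j) f (q 0))"
    and fsS: "fs (Suc k) = S (Suc k) (\<lambda>j. (deriv ^^ j) (fs k) (q (Suc k)))" for k
    unfolding fs_def by simp_all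
  have fs_eig: "fs k \<in> eigenfunctions (L4 u) lam (ball (q k) \<delta>)" if "k \<le> N" for k
    using S[OF that] fs0 fsS by (cases k) auto
  have q0: "q 0 = pathstart \<gamma>" unfolding q_def pathstart_def by simp
  have qN: "q N = pathfinish \<gamma>" unfolding q_def pathfinish_def using N by simp
  have jets0: "(deriv ^^ j) (fs 0) (q 0) = (deriv ^^ j) f (q 0)" if "j < 4" for j
    using S[of 0] that unfolding fs0 by simp
  have jetsS: "(deriv ^^ j) (fs (Suc k)) (q (Suc k)) = (deriv ^^ j) (fs k) (q (Suc k))" if "j < 4" "Suc k \<le> N" for j k
    using S[OF that(2)] that(1) unfolding fsS by simp
  have q_close: "q (Suc k) \<in> ball (q k) \<delta>" if "Suc k \<le> N" for k
    unfolding q_def mem_ball using that N by (intro close node) auto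
  have agree: "fs (Suc k) z = fs k z" if k: "Suc k \<le> N" and z: "z \<in> ball (q k) \<delta> \<inter> ball (q (Suc k)) \<delta>" for k z
  proof (rule eigenfunctions_eqI[OF _ _ _ _ _ _ _ z])
    show "connected (ball (q k) \<delta> \<inter> ball (q (Suc k)) \<delta>)"
      by (intro convex_connected convex_Int convex_ball)
    show "u analytic_on ball (q k) \<delta> \<inter> ball (q (Suc k)) \<delta>"
      using an[OF node[of k]] k unfolding q_def by (auto intro: analytic_on_subset)
    show "q (Suc k) \<in> ball (q k) \<delta> \<inter> ball (q (Suc k)) \<delta>" using q_close[OF k] \<delta>(1) by simp
    show "fs (Suc k) \<in> eigenfunctions (L4 u) lam (ball (q k) \<delta> \<inter> ball (q (Suc k)) \<delta>)"
      by (rule eigenfunctions_subset[OF fs_eig[OF k]]) auto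
    show "fs k \<in> eigenfunctions (L4 u) lam (ball (q k) \<delta> \<inter> ball (q (Suc k)) \<delta>)"
      by (rule eigenfunctions_subset[OF fs_eig[of k]]) (use k in auto)
  qed (use jetsS k in auto)
  define idx where "idx = (\<lambda>t::real. nat \<lfloor>t * N\<rfloor>)"
  have idx: "idx t \<le> N" "real (idx t) \<le> t * N" "t * N < real (idx t) + 1" if "t \<in> {0..1}" for t
  proof -
    have "0 \<le> t * N" using that by simp
    then show "real (idx t) \<le> t * N" "t * N < real (idx t) + 1" unfolding idx_def by linarith+
    have "t * N \<le> real N" using that mult_right_mono[of t 1 "real N"] by simp
    with \<open>real (idx t) \<le> t * N\<close> have "real (idx t) \<le> real N" by linarith
    then show "idx t \<le> N" by simp
  qed
  have in_ball: "\<gamma> t \<in> ball (q (idx t)) \<delta>" if "t \<in> {0..1}" for t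
    unfolding q_def mem_ball using idx[OF that] N by (intro close node that) auto
  have cont: "continues_along \<gamma> f (fs N)"
    unfolding continues_along_def
  proof (intro conjI exI[of _ "\<lambda>t. fs (idx t)"] ballI)
    show "path \<gamma>" by (rule \<gamma>(1))
  next
    fix t :: real assume t: "t \<in> {0..1}"
    show "fs (idx t) analytic_on {\<gamma> t}"
      using in_ball[OF t] fs_eig[OF idx(1)[OF t]] unfolding eigenfunctions_def analytic_at
      by (auto intro!: exI[of _ "ball (q (idx t)) \<delta>"])
    let ?k = "idx t"
    \<comment> \<open>Within distance \<eta> of t the index does not increase, and it decreases by at most one.\<close>
    define \<eta> where "\<eta> = min (real ?k + 1 - t * N) 1 / N"
    have \<eta>: "\<eta> > 0" unfolding \<eta>_def using idx(3)[OF t] N by simp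
    show "\<forall>\<^sub>F s in at t within {0..1}. \<forall>\<^sub>F z in nhds (\<gamma> s). fs (idx s) z = fs ?k z"
      unfolding eventually_at
    proof (intro exI[of _ \<eta>] conjI ballI impI \<eta>)
      fix s assume s: "s \<in> {0..1}" "s \<noteq> t \<and> dist s t < \<eta>"
      have "\<bar>s - t\<bar> * N < min (real ?k + 1 - t * N) 1"
        using s N unfolding \<eta>_def dist_real_def by (simp add: pos_less_divide_eq)
      then have "\<bar>s * N - t * N\<bar> < min (real ?k + 1 - t * N) 1"
        by (simp add: abs_mult flip: left_diff_distrib)
      then have "s * N < real ?k + 1" "s * N > t * N - 1" by linarith+
      then have "real (idx s) < real ?k + 1" "real ?k < real (idx s) + 2"
        using idx[OF s(1)] idx[OF t] by linarith+
      then have idx_s: "idx s = ?k \<or> Suc (idx s) = ?k" by linarith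
      show "\<forall>\<^sub>F z in nhds (\<gamma> s). fs (idx s) z = fs ?k z"
      proof (cases "idx s = ?k")
        case False
        then have k: "Suc (idx s) = ?k" using idx_s by simp
        have kN: "Suc (idx s) \<le> N" using k idx(1)[OF t] by simp
        have "\<gamma> s \<in> ball (q (Suc (idx s))) \<delta>"
          unfolding q_def mem_ball using idx[OF s(1)] N kN by (intro close node s) auto
        then have "\<gamma> s \<in> ball (q (idx s)) \<delta> \<inter> ball (q (Suc (idx s))) \<delta>"
          using in_ball[OF s(1)] by simp
        then have "\<forall>\<^sub>F z in nhds (\<gamma> s). z \<in> ball (q (idx s)) \<delta> \<inter> ball (q (Suc (idx s))) \<delta>"
          by (intro eventually_nhds_in_open) auto
        then show ?thesis
          by eventually_elim (use agree[OF kN] k in auto)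
      qed simp
    qed
  next
    obtain \<epsilon> where \<epsilon>: "\<epsilon> > 0" "ball (pathstart \<gamma>) \<epsilon> \<subseteq> U" using f(1,2) openE by blast
    define W where "W = ball (pathstart \<gamma>) (min \<epsilon> \<delta>)"
    have WU: "W \<subseteq> U" and W\<delta>: "W \<subseteq> ball (q 0) \<delta>" using \<epsilon> unfolding W_def q0 by auto
    have "fs 0 z = f z" if "z \<in> W" for z
    proof (rule eigenfunctions_eqI[OF _ _ _ _ _ _ _ that])
      show "u analytic_on W" using f(3) WU by (rule analytic_on_subset)
      show "fs 0 \<in> eigenfunctions (L4 u) lam W" using fs_eig[of 0] W\<delta> by (auto intro: eigenfunctions_subset)
      show "f \<in> eigenfunctions (L4 u) lam W" using f(4) WU by (rule eigenfunctions_subset)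
      show "q 0 \<in> W" unfolding W_def q0 using \<epsilon>(1) \<delta>(1) by simp
    qed (use jets0 in \<open>auto simp: W_def\<close>)
    moreover have "\<forall>\<^sub>F z in nhds (pathstart \<gamma>). z \<in> W"
      unfolding W_def using \<epsilon>(1) \<delta>(1) by (intro eventually_nhds_in_open) auto
    ultimately show "\<forall>\<^sub>F z in nhds (pathstart \<gamma>). fs (idx 0) z = f z"
      by (auto elim!: eventually_mono simp: idx_def)
  next
    have "idx 1 = N" unfolding idx_def by simp
    then show "\<forall>\<^sub>F z in nhds (pathfinish \<gamma>). fs (idx 1) z = fs N z" by simp
  qed
  have zero: "\<forall>j<4. (deriv ^^ j) f (q 0) = 0" if "k \<le> N" "\<forall>z\<in>ball (q k) \<delta>. fs k z = 0" for k
    using that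
  proof (induction k)
    case 0
    then show ?case
      using higher_deriv_eq_0[of "ball (q 0) \<delta>" "q 0" "fs 0"] jets0 \<delta>(1) by simp
  next
    case (Suc k)
    have jets: "(deriv ^^ j) (fs k) (q (Suc k)) = 0" if "j < 4" for j
      using higher_deriv_eq_0[of "ball (q (Suc k)) \<delta>" "q (Suc k)" "fs (Suc k)" j] Suc.prems jetsS[OF that]
        \<delta>(1) by simp
    have "fs k z = 0" if "z \<in> ball (q k) \<delta>" for z
    proof (rule eigenfunction_eq_0[OF open_ball connected_ball _ _ q_close[OF Suc.prems(1)] jets that])
      show "u analytic_on ball (q k) \<delta>" unfolding q_def using Suc.prems(1) by (intro an node) simp
      show "fs k \<in> eigenfunctions (L4 u) lam (ball (q k) \<delta>)" using Suc.prems(1) by (intro fs_eig) simp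
    qed
    then show ?case using Suc by simp
  qed
  show ?thesis
    using \<delta>(1) fs_eig[of N] cont zero[of N] unfolding qN q0 by blast
qed

section \<open>Branch points\<close>

text \<open>
  Near the end q of the path, the continued solution is a combination of the four powers, and this
  combination defines \<Phi> on the half-plane that covers the punctured disc. If \<Phi> had the
  period 2 pi i, independence would give c r (exp (2 pi i \<sigma> r) - 1) = 0 for every r, hence
  c r = 0.
\<close>
lemma solution_has_branch_point:
  fixes \<sigma> :: "nat \<Rightarrow> complex" and a :: complex
  assumes u: "u meromorphic_on UNIV" and pole: "is_pole u a"
    and \<rho>: "\<rho> > 0" "u analytic_on (ball a \<rho> - {a})"
    and G: "\<And>r. r \<in> {1..4} \<Longrightarrow> G r holomorphic_on ball a \<rho>"
    and basis: "\<forall>U l. open U \<and> connected U \<and> U \<noteq> {} \<and> U \<subseteq> ball a \<rho> - {a} \<and>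
               l holomorphic_on U \<and> (\<forall>x\<in>U. exp (l x) = x - a) \<longrightarrow>
           basis_on U (eigenfunctions (L4 u) lam U) {1..4} (\<lambda>r x. exp (\<sigma> r * l x) * G r x)"
    and \<sigma>: "\<And>r. r \<in> {1..4} \<Longrightarrow> \<sigma> r \<notin> \<int>"
    and U: "open U" "connected U" "u analytic_on U" and \<psi>: "\<psi> \<in> eigenfunctions (L4 u) lam U"
    and nz: "x0 \<in> U" "\<psi> x0 \<noteq> 0" and p: "p \<in> U"
  shows "has_branch_point \<psi> p a"
proof -
  define D where "D = {z. u analytic_on {z}}"
  have D_open: "open D"
    unfolding open_subopen[of D]
  proof
    fix z assume "z \<in> D"
    then obtain S where S: "open S" "z \<in> S" "u holomorphic_on S" unfolding D_def analytic_at by blast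
    then have "S \<subseteq> D" unfolding D_def analytic_at by blast
    then show "\<exists>T. open T \<and> z \<in> T \<and> T \<subseteq> D" using S by blast
  qed
  have D_an: "u analytic_on D" by (subst analytic_on_analytic_at) (simp add: D_def)
  have "{z. \<not> u analytic_on {z}} sparse_in UNIV" by (rule meromorphic_on_imp_sparse_singularities[OF u])
  moreover have "- D = {z. \<not> u analytic_on {z}}" unfolding D_def by auto
  ultimately have "countable (- D)" using sparse_imp_countable[OF open_UNIV] by simp
  then have D_conn: "path_connected D" using path_connected_complement_countable[of "- D"] by simp
  define q where "q = a + of_real (\<rho> / 2)"
  define s0 where "s0 = Ln (of_real (\<rho> / 2))"
  have qa: "exp s0 = q - a" "q \<noteq> a" unfolding s0_def q_def using \<rho>(1) by auto
  have Re_s0: "Re s0 < ln \<rho>" unfolding s0_def using \<rho>(1) by simp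
  have qD: "q \<in> D"
  proof -
    have "q \<in> ball a \<rho> - {a}" unfolding q_def using \<rho>(1) by (simp add: dist_norm)
    then show ?thesis unfolding D_def by (auto intro: analytic_on_subset[OF \<rho>(2)])
  qed
  have "p \<in> D" unfolding D_def using p by (auto intro: analytic_on_subset[OF U(3)])
  then obtain \<gamma> where \<gamma>: "path \<gamma>" "path_image \<gamma> \<subseteq> D" "pathstart \<gamma> = p" "pathfinish \<gamma> = q"
    using D_conn qD unfolding path_connected_def by blast
  obtain \<delta> h where \<delta>: "\<delta> > 0" and h: "h \<in> eigenfunctions (L4 u) lam (ball q \<delta>)" "continues_along \<gamma> \<psi> h"
      "(\<forall>z\<in>ball q \<delta>. h z = 0) \<Longrightarrow> \<forall>j<4. (deriv ^^ j) \<psi> p = 0"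
    using continue_eigenfunction_along_path[OF D_open D_an \<gamma>(1,2) U(1) _ U(3) \<psi>] p unfolding \<gamma>(3,4) by blast
  have h_nz: "\<exists>z\<in>ball q \<delta>. h z \<noteq> 0"
  proof (rule ccontr)
    assume "\<not> ?thesis"
    then have "\<forall>j<4. (deriv ^^ j) \<psi> p = 0" using h(3) by blast
    then have "\<psi> x0 = 0" by (intro eigenfunction_eq_0[OF U \<psi> p _ nz(1)]) auto
    then show False using nz by simp
  qed
  define V where "V = ball q (min \<delta> (\<rho> / 2))"
  have V: "open V" "connected V" "V \<noteq> {}" "q \<in> V" "V \<subseteq> ball q \<delta>"
    unfolding V_def using \<delta> \<rho>(1) by auto
  have dqa: "dist q a = \<rho> / 2" unfolding q_def using \<rho>(1) by (simp add: dist_norm)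
  have V_sub: "V \<subseteq> ball a \<rho> - {a}"
  proof
    fix x assume "x \<in> V"
    then have "dist q x < \<rho> / 2" unfolding V_def by simp
    then show "x \<in> ball a \<rho> - {a}"
      using dqa dist_triangle[of a x q] by (auto simp: dist_commute)
  qed
  \<comment> \<open>The branch of log (x - a) with the value s0 at q; the quotient stays within distance 1 of 1.\<close>
  define l where "l = (\<lambda>x. Ln ((x - a) / (q - a)) + s0)"
  have nonpos: "(x - a) / (q - a) \<notin> \<real>\<^sub>\<le>\<^sub>0" if "x \<in> V" for x
  proof
    assume "(x - a) / (q - a) \<in> \<real>\<^sub>\<le>\<^sub>0"
    then have "Re ((x - a) / (q - a)) \<le> 0" by (auto simp: complex_nonpos_Reals_iff)
    moreover have "(x - a) / (q - a) - 1 = (x - q) / (q - a)" using qa(2) by (simp add: field_simps)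
    then have "norm ((x - a) / (q - a) - 1) = norm (x - q) / norm (q - a)" by (simp add: norm_divide)
    moreover have "norm (x - q) / norm (q - a) < 1"
    proof -
      have "norm (x - q) < norm (q - a)" "0 < norm (q - a)"
        using that dqa \<rho>(1) unfolding V_def by (auto simp: dist_norm norm_minus_commute)
      then show ?thesis by simp
    qed
    ultimately show False
      using abs_Re_le_cmod[of "(x - a) / (q - a) - 1"] by simp
  qed
  have l_hol: "l holomorphic_on V"
    unfolding l_def using qa(2) nonpos by (intro holomorphic_intros) auto
  have l_exp: "exp (l x) = x - a" if "x \<in> V" for x
  proof -
    have "x \<noteq> a" using that V_sub by auto
    then show ?thesis unfolding l_def exp_add qa(1) using qa(2) by simp
  qed
  have bas: "basis_on V (eigenfunctions (L4 u) lam V) {1..4} (\<lambda>r x. exp (\<sigma> r * l x) * G r x)"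
    by (rule basis[THEN spec, THEN spec, THEN mp]) (use V V_sub l_hol l_exp in blast)
  have hV: "h \<in> eigenfunctions (L4 u) lam V" by (rule eigenfunctions_subset[OF h(1) V(5)])
  from bas hV obtain c where c: "\<And>z. z \<in> V \<Longrightarrow> h z = (\<Sum>r\<in>{1..4}. c r * (exp (\<sigma> r * l z) * G r z))"
    unfolding basis_on_def by blast
  have ind: "\<forall>r\<in>{1..4}. c' r = 0" if "\<And>z. z \<in> V \<Longrightarrow> (\<Sum>r\<in>{1..4}. c' r * (exp (\<sigma> r * l z) * G r z)) = 0" for c'
    using bas that unfolding basis_on_def by blast
  define \<Phi> where "\<Phi> = (\<lambda>s. \<Sum>r\<in>{1..4}. c r * (exp (\<sigma> r * s) * G r (a + exp s)))"
  have exp_in: "a + exp s \<in> ball a \<rho>" if "Re s < ln \<rho>" for s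
  proof -
    have "norm (exp s) < exp (ln \<rho>)" using that by (simp del: exp_ln)
    then show ?thesis using \<rho>(1) by (simp add: dist_norm)
  qed
  have \<Phi>_hol: "\<Phi> holomorphic_on {s. Re s < ln \<rho>}"
  proof -
    have "(\<lambda>s. G r (a + exp s)) holomorphic_on {s. Re s < ln \<rho>}" if "r \<in> {1..4}" for r
      by (rule holomorphic_on_compose_gen[OF _ G[OF that], unfolded o_def])
         (use exp_in in \<open>auto intro!: holomorphic_intros\<close>)
    then show ?thesis unfolding \<Phi>_def by (intro holomorphic_intros) auto
  qed
  have near: "\<forall>\<^sub>F s in nhds s0. \<Phi> s = h (a + exp s)"
  proof -
    let ?S = "(\<lambda>s. a + exp s) -` V \<inter> ball s0 1"
    have "open ?S"
      by (intro open_Int open_vimage V continuous_intros open_ball)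
    moreover have "s0 \<in> ?S" using qa(1) V(4) by simp
    ultimately have "\<forall>\<^sub>F s in nhds s0. s \<in> ?S" by (rule eventually_nhds_in_open)
    then show ?thesis
    proof eventually_elim
      case (elim s)
      have "\<bar>Im (s - s0)\<bar> < 1"
        using elim abs_Im_le_cmod[of "s - s0"] by (simp add: dist_norm norm_minus_commute)
      then have Im: "- pi < Im (s - s0)" "Im (s - s0) \<le> pi" using pi_gt3 by linarith+
      have "l (a + exp s) = Ln (exp (s - s0)) + s0"
        unfolding l_def qa(1)[symmetric] by (simp add: exp_diff)
      then have "l (a + exp s) = s" using Ln_exp[OF Im] by simp
      then show ?case using c[of "a + exp s"] elim unfolding \<Phi>_def by simp
    qed
  qed
  have "\<exists>s. Re s < ln \<rho> \<and> \<Phi> (s + 2 * of_real pi * \<i>) \<noteq> \<Phi> s"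
  proof (rule ccontr)
    assume *: "\<not> ?thesis"
    have "(\<Sum>r\<in>{1..4}. (c r * (exp (\<sigma> r * (2 * of_real pi * \<i>)) - 1)) * (exp (\<sigma> r * l z) * G r z)) = 0"
      if z: "z \<in> V" for z
    proof -
      have nz: "norm (z - a) < \<rho>" "z \<noteq> a"
        using z V_sub by (auto simp: dist_norm norm_minus_commute)
      have "norm (exp (l z)) < exp (ln \<rho>)" unfolding l_exp[OF z] using nz(1) \<rho>(1) by simp
      then have "Re (l z) < ln \<rho>" by (simp del: exp_ln)
      then have "\<Phi> (l z + 2 * of_real pi * \<i>) = \<Phi> (l z)" using * by blast
      moreover have "exp (l z + 2 * of_real pi * \<i>) = exp (l z)"
        using exp_plus_2pin[of "l z" 1] by (simp add: mult.commute mult.left_commute)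
      ultimately have "(\<Sum>r\<in>{1..4}. c r * (exp (\<sigma> r * (l z + 2 * of_real pi * \<i>)) * G r z)
          - c r * (exp (\<sigma> r * l z) * G r z)) = 0"
        unfolding \<Phi>_def sum_subtractf using l_exp[OF z] by simp
      then show ?thesis by (simp add: ring_distribs exp_add algebra_simps)
    qed
    then have 0: "\<forall>r\<in>{1..4}. c r * (exp (\<sigma> r * (2 * of_real pi * \<i>)) - 1) = 0" by (rule ind)
    have "c r = 0" if r: "r \<in> {1..4}" for r
    proof (rule ccontr)
      assume "c r \<noteq> 0"
      then have "exp (\<sigma> r * (2 * of_real pi * \<i>)) = 1" using 0 r by auto
      then obtain k :: int where "Im (\<sigma> r * (2 * of_real pi * \<i>)) = of_int (2 * k) * pi"
          "Re (\<sigma> r * (2 * of_real pi * \<i>)) = 0"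
        unfolding exp_eq_1 by blast
      then have "Re (\<sigma> r) = of_int k" "Im (\<sigma> r) = 0" by auto
      then have "\<sigma> r = of_int k" by (simp add: complex_eq_iff)
      then show False using \<sigma>[OF r] by simp
    qed
    then have "h z = 0" if "z \<in> V" for z using c[OF that] by simp
    then have "h z = 0" if "z \<in> ball q \<delta>" for z
      using analytic_continuation_open[OF V(1) open_ball V(3) connected_ball V(5), of h "\<lambda>_. 0"] h(1) that
      by (auto simp: eigenfunctions_def)
    then show False using h_nz by blast
  qed
  then have *: "\<Phi> holomorphic_on {s. Re s < ln \<rho>} \<and> Re s0 < ln \<rho> \<and>
        pathstart \<gamma> = p \<and> pathfinish \<gamma> = a + exp s0 \<and> continues_along \<gamma> \<psi> h \<and>
        (\<forall>\<^sub>F s in nhds s0. \<Phi> s = h (a + exp s)) \<and>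
        (\<exists>s. Re s < ln \<rho> \<and> \<Phi> (s + 2 * of_real pi * \<i>) \<noteq> \<Phi> s)"
    using \<Phi>_hol Re_s0 \<gamma>(3,4) qa(1) h(2) near by simp
  show ?thesis
    unfolding has_branch_point_def
    by (rule exI[of _ \<rho>], rule conjI[OF \<rho>(1)], rule exI[of _ \<Phi>],
        rule exI[of _ s0], rule exI[of _ \<gamma>], rule exI[of _ h], rule *)
qed

section \<open>The exponents at a pole\<close>

text \<open>
  With y = s^2 - 3s + 1 the left side is y^2 - ((1 + 2N) d)^2, and the two factors are the pairs of
  exponents with sum 3.
\<close>
lemma indicial_polynomial_factorization:
  fixes N d s s1 s2 s3 s4 :: complex
  assumes d: "d\<^sup>2 = 1 - 16 * N - 16 * N\<^sup>2"
    and s: "s1 = 1 / 2 * (1 - 4 * N - d)" "s2 = 1 / 2 * (1 - 4 * N + d)"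
      "s3 = 1 / 2 * (5 + 4 * N - d)" "s4 = 1 / 2 * (5 + 4 * N + d)"
  shows "poly quartic s + N * (4 * N + 1) * (4 * N + 3) * (4 * N + 4) = (s - s1) * (s - s2) * (s - s3) * (s - s4)"
proof -
  define y where "y = s\<^sup>2 - 3 * s + 1"
  have dd: "d * d = 1 - 16 * N - 16 * (N * N)" using d by (simp add: power2_eq_square)
  have 14: "(s - s1) * (s - s4) = y - (1 + 2 * N) * d"
    unfolding s y_def by (simp add: field_simps power2_eq_square dd)
  have 23: "(s - s2) * (s - s3) = y + (1 + 2 * N) * d"
    unfolding s y_def by (simp add: field_simps power2_eq_square dd)
  have "(s - s1) * (s - s2) * (s - s3) * (s - s4) = ((s - s1) * (s - s4)) * ((s - s2) * (s - s3))"
    by (simp only: ac_simps)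
  also have "\<dots> = y\<^sup>2 - (1 + 2 * N)\<^sup>2 * d\<^sup>2"
    unfolding 14 23 by (simp add: algebra_simps power2_eq_square)
  also have "\<dots> = poly quartic s + N * (4 * N + 1) * (4 * N + 3) * (4 * N + 4)"
    unfolding d y_def poly_quartic by (simp add: algebra_simps power2_eq_square)
  finally show ?thesis by simp
qed

theorem theorem1p5:
  fixes u :: "complex \<Rightarrow> complex" and M :: diffop and a :: complex and g n :: nat
    and \<sigma> :: "nat \<Rightarrow> complex"
  assumes "u meromorphic_on UNIV"
    and "diffop_of_order (4 * g + 2) M"
    and "ops_commute (L4 u) M"
    and "has_rank (L4 u) M 2"
    and "is_pole u a"
    and "n > 0"
    and "fls_nth (laurent_expansion u a) (-4) = of_nat (n * (4 * n + 1) * (4 * n + 3) * (4 * n + 4))"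
    and "\<sigma> 1 = 1 / 2 * (1 - 4 * of_nat n - csqrt (1 - 16 * of_nat n - 16 * (of_nat n)\<^sup>2))"
    and "\<sigma> 2 = 1 / 2 * (1 - 4 * of_nat n + csqrt (1 - 16 * of_nat n - 16 * (of_nat n)\<^sup>2))"
    and "\<sigma> 3 = 1 / 2 * (5 + 4 * of_nat n - csqrt (1 - 16 * of_nat n - 16 * (of_nat n)\<^sup>2))"
    and "\<sigma> 4 = 1 / 2 * (5 + 4 * of_nat n + csqrt (1 - 16 * of_nat n - 16 * (of_nat n)\<^sup>2))"
  shows "(\<forall>lam. has_fundamental_system u lam a \<sigma>) \<and>
    (\<forall>lam \<mu> U \<psi>. connected U \<and> ordinary_on (L4 u) U \<and> ordinary_on M U \<and>
        \<psi> \<in> eigenfunctions (L4 u) lam U \<inter> eigenfunctions M \<mu> U \<and> (\<exists>x\<in>U. \<psi> x \<noteq> 0) \<longrightarrow>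
        (\<forall>p\<in>U. has_branch_point \<psi> p a)) \<and>
    (\<forall>m N. odd m \<and> diffop_of_order m N \<longrightarrow> \<not> ops_commute (L4 u) N)"
proof -
  define F where "F = laurent_expansion u a"
  define d where "d = csqrt (1 - 16 * of_nat n - 16 * (of_nat n)\<^sup>2)"
  define K where "K = 4 * n + 2"
  let ?Q = "\<lambda>s. poly quartic s + fls_nth F (-4)"
  have d2: "d\<^sup>2 = 1 - 16 * of_nat n - 16 * (of_nat n)\<^sup>2" unfolding d_def by simp
  have \<sigma>: "\<sigma> 1 = 1 / 2 * (1 - 4 * of_nat n - d)" "\<sigma> 2 = 1 / 2 * (1 - 4 * of_nat n + d)"
      "\<sigma> 3 = 1 / 2 * (5 + 4 * of_nat n - d)" "\<sigma> 4 = 1 / 2 * (5 + 4 * of_nat n + d)"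
    unfolding d_def using assms(8-11) by blast+
  \<comment> \<open>The radicand is negative for n > 0, so the exponents are not real.\<close>
  have Im_d: "Im d \<noteq> 0"
  proof
    assume "Im d = 0"
    then have "Re (d\<^sup>2) = (Re d)\<^sup>2" by (simp add: power2_eq_square)
    then have "0 \<le> Re (d\<^sup>2)" by simp
    also have "Re (d\<^sup>2) = 1 - 16 * real n - 16 * (real n)\<^sup>2"
      unfolding d2 by (simp add: power2_eq_square)
    also have "\<dots> < 0"
    proof -
      have "real n \<ge> 1" "(real n)\<^sup>2 \<ge> 0" using \<open>n > 0\<close> by auto
      then show ?thesis by linarith
    qed
    finally show False by simp
  qed
  have Q: "?Q s = (s - \<sigma> 1) * (s - \<sigma> 2) * (s - \<sigma> 3) * (s - \<sigma> 4)" for s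
  proof -
    have "fls_nth F (-4) = of_nat n * (4 * of_nat n + 1) * (4 * of_nat n + 3) * (4 * of_nat n + 4)"
      using assms(7) unfolding F_def by (simp only: of_nat_mult of_nat_add of_nat_numeral of_nat_1)
    then show ?thesis
      using indicial_polynomial_factorization[OF d2 \<sigma>, of s] by (simp only:)
  qed
  have gap: "\<sigma> 3 = \<sigma> 1 + of_nat K" "\<sigma> 4 = \<sigma> 2 + of_nat K"
    unfolding \<sigma> K_def by (simp_all add: field_simps)
  have nonreal: "Im (\<sigma> r) \<noteq> 0" if "r \<in> {1..4}" for r
    using that Im_d unfolding one_to_four by (auto simp: \<sigma> simp del: One_nat_def)
  have nonint: "z \<notin> \<int>" if "Im z \<noteq> 0" for z
    using that by (auto elim: Ints_cases)
  have roots1: "z = 0 \<or> z = int K" if "?Q (\<sigma> 1 + of_int z) = 0" for z :: int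
  proof -
    have "Im (\<sigma> 1 + of_int z - \<sigma> 2) \<noteq> 0" "Im (\<sigma> 1 + of_int z - \<sigma> 4) \<noteq> 0"
      using Im_d by (auto simp: \<sigma> simp del: One_nat_def)
    then have "\<sigma> 1 + of_int z - \<sigma> 2 \<noteq> 0" "\<sigma> 1 + of_int z - \<sigma> 4 \<noteq> 0"
      by (metis zero_complex.sel(2))+
    then have "of_int z = (0 :: complex) \<or> of_int z = (of_nat K :: complex)"
      using that unfolding Q gap(1) by auto
    then show ?thesis by (metis of_int_eq_0_iff of_int_eq_iff of_int_of_nat_eq)
  qed
  have roots2: "z = 0 \<or> z = int K" if "?Q (\<sigma> 2 + of_int z) = 0" for z :: int
  proof -
    have "Im (\<sigma> 2 + of_int z - \<sigma> 1) \<noteq> 0" "Im (\<sigma> 2 + of_int z - \<sigma> 3) \<noteq> 0"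
      using Im_d by (auto simp: \<sigma> simp del: One_nat_def)
    then have "\<sigma> 2 + of_int z - \<sigma> 1 \<noteq> 0" "\<sigma> 2 + of_int z - \<sigma> 3 \<noteq> 0"
      by (metis zero_complex.sel(2))+
    then have "of_int z = (0 :: complex) \<or> of_int z = (of_nat K :: complex)"
      using that unfolding Q gap(2) by auto
    then show ?thesis by (metis of_int_eq_0_iff of_int_eq_iff of_int_of_nat_eq)
  qed
  from commuting_symbols_of_commuting_operators[OF assms(1-3), of a] obtain B D where
    M: "commuting_symbols (fls_nth F) (symbol (map (\<lambda>c. laurent_expansion c a) M)) (4 * g + 2) B D"
    unfolding F_def by blast
  have not4: "\<not> 4 dvd 4 * g + 2" by presburger
  have reg: "fls_nth F i = 0" if "i < -4" for i
    by (rule commuting_symbols.pole_order_le_4[OF M not4 that])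
  have sols: "\<exists>f. f 0 \<noteq> 0 \<and> (\<forall>k. act (local_symbol F lam) (\<sigma> r) f k = 0)" if "r \<in> {1..4}" for r lam
  proof -
    have zeros: "?Q (\<sigma> 1) = 0" "?Q (\<sigma> 1 + of_nat K) = 0" "?Q (\<sigma> 2) = 0" "?Q (\<sigma> 2 + of_nat K) = 0"
      unfolding gap[symmetric] Q by simp_all
    note low = commuting_symbols.frobenius_solutions_exist[OF M reg not4 zeros(1,2) roots1,
        where lam = lam, folded local_symbol_def gap]
    note high = commuting_symbols.frobenius_solutions_exist[OF M reg not4 zeros(3,4) roots2,
        where lam = lam, folded local_symbol_def gap]
    show ?thesis using that low high unfolding one_to_four by blast
  qed
  have "K > 0" unfolding K_def by simp
  have "Im (\<sigma> 1 - \<sigma> 2) \<noteq> 0" using Im_d by (simp add: \<sigma> del: One_nat_def)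
  then have nonint12: "\<sigma> 1 - \<sigma> 2 \<notin> \<int>" by (rule nonint)
  have reg': "\<forall>i < -4. fls_nth F i = 0" using reg by blast
  have sols': "\<forall>r\<in>{1..4}. \<exists>f. f 0 \<noteq> 0 \<and> (\<forall>k. act (local_symbol F lam) (\<sigma> r) f k = 0)" for lam
    using sols by blast
  note fb = frobenius_basis[OF assms(1), of a, folded F_def, OF reg' sols' gap \<open>K > 0\<close> nonint12]
  have "has_fundamental_system u lam a \<sigma>" for lam
  proof -
    from fb[of lam] obtain \<rho> G where "\<rho> > 0" "u analytic_on (ball a \<rho> - {a})"
      and "\<forall>r\<in>{1..4::nat}. G r holomorphic_on ball a \<rho> \<and> G r a \<noteq> 0"
      and "\<forall>U l. open U \<and> connected U \<and> U \<noteq> {} \<and> U \<subseteq> ball a \<rho> - {a} \<and>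
               l holomorphic_on U \<and> (\<forall>x\<in>U. exp (l x) = x - a) \<longrightarrow>
           basis_on U (eigenfunctions (L4 u) lam U) {1..4} (\<lambda>r x. exp (\<sigma> r * l x) * G r x)"
      by (elim exE conjE) (rule that)
    then show ?thesis
      unfolding has_fundamental_system_def by (intro exI[of _ \<rho>] exI[of _ G] conjI) simp_all
  qed
  moreover have "has_branch_point \<psi> p a"
    if "connected U" "ordinary_on (L4 u) U" "\<psi> \<in> eigenfunctions (L4 u) lam U" "x \<in> U" "\<psi> x \<noteq> 0" "p \<in> U"
    for lam U \<psi> x p
  proof -
    from fb[of lam] obtain \<rho> G where \<rho>: "\<rho> > 0" "u analytic_on (ball a \<rho> - {a})"
      and G: "\<forall>r\<in>{1..4::nat}. G r holomorphic_on ball a \<rho> \<and> G r a \<noteq> 0"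
      and bas: "\<forall>U l. open U \<and> connected U \<and> U \<noteq> {} \<and> U \<subseteq> ball a \<rho> - {a} \<and>
               l holomorphic_on U \<and> (\<forall>x\<in>U. exp (l x) = x - a) \<longrightarrow>
           basis_on U (eigenfunctions (L4 u) lam U) {1..4} (\<lambda>r x. exp (\<sigma> r * l x) * G r x)"
      by (elim exE conjE) (rule that)
    have G': "G r holomorphic_on ball a \<rho>" if "r \<in> {1..4}" for r using G that by blast
    have "open U" "u analytic_on U" using that(2) by (auto simp: ordinary_on_def L4_def)
    from solution_has_branch_point[OF assms(1,5) \<rho> G' bas nonint[OF nonreal] this(1) that(1) this(2) that(3-6)]
    show ?thesis .
  qed
  moreover have "\<not> ops_commute (L4 u) N" if "odd m" "diffop_of_order m N" for m N
  proof
    assume "ops_commute (L4 u) N"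
    from commuting_symbols_of_commuting_operators[OF assms(1) that(2) this, of a] obtain B D where
      N: "commuting_symbols (fls_nth F) (symbol (map (\<lambda>c. laurent_expansion c a) N)) m B D"
      unfolding F_def by blast
    have "?Q (\<sigma> 1 + of_int z) \<noteq> 0" if "odd z" for z :: int
      using roots1[of z] that unfolding K_def by auto
    moreover have "?Q (\<sigma> 1) = 0" unfolding Q by simp
    ultimately have "even m" by (intro commuting_symbols.order_even[OF N reg])
    then show False using that(1) by simp
  qed
  ultimately show ?thesis by blast
qed

end
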